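(* In the regular pentagon process, almost surely the limit pentagon $K_\infty=\bigcap_n K_n$ has exactly one height equal to $\rho_5$ (and all other heights strictly smaller than $\rho_5$).
   Context: $K\subset\mathbb R^2$ is the regular pentagon with circumradius $1$, centroid at the origin and $(0,1)$ a vertex; $v_1,\dots,v_5$ are the position vectors of its vertices, and $\rho_5=\cos(\pi/5)$. The regular pentagon process: $K_0=K$, $p_{n+1}$ uniform random point in $K_n$ (conditionally on the past), $K_{n+1}=K_n\cap(p_{n+1}+K)$. For a compact convex set $L$, its $i$th height is $\max_{x\in L}\langle x,v_i\rangle-\min_{x\in L}\langle x,v_i\rangle$. *)

theory Defs
  imports "HOL-Probability.Probability"
begin

text \<open>Vertices v_1..v_5 (indexed 0..4) of the regular pentagon with circumradius 1,
  centroid at the origin, and (0,1) a vertex.\<close>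
definition pent_vertex :: "nat \<Rightarrow> real \<times> real" where
  "pent_vertex i = (sin (2 * pi * real i / 5), cos (2 * pi * real i / 5))"

definition pentK :: "(real \<times> real) set" where
  "pentK = convex hull (pent_vertex ` {..<5})"

definition rho5 :: real where
  "rho5 = cos (pi / 5)"

text \<open>K_n for the point sequence p, where p n is the point p_{n+1}:
  K_n = K \<inter> (p_1 + K) \<inter> ... \<inter> (p_n + K).\<close>
definition Kn :: "(nat \<Rightarrow> real \<times> real) \<Rightarrow> nat \<Rightarrow> (real \<times> real) set" where
  "Kn p n = pentK \<inter> (\<Inter>i<n. (\<lambda>x. p i + x) ` pentK)"

definition Kinf :: "(nat \<Rightarrow> real \<times> real) \<Rightarrow> (real \<times> real) set" where
  "Kinf p = (\<Inter>n. Kn p n)"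

definition pent_height :: "(real \<times> real) set \<Rightarrow> nat \<Rightarrow> real" where
  "pent_height L i = (SUP x\<in>L. x \<bullet> pent_vertex i) - (INF x\<in>L. x \<bullet> pent_vertex i)"

text \<open>P is a regular pentagon process on the probability space M:
  P \<omega> n is the point p_{n+1}; conditionally on p_1..p_n it is uniform on K_n.\<close>
definition pentagon_process :: "'a measure \<Rightarrow> ('a \<Rightarrow> nat \<Rightarrow> real \<times> real) \<Rightarrow> bool" where
  "pentagon_process M P \<longleftrightarrow>
     prob_space M \<and>
     (\<forall>n. (\<lambda>\<omega>. P \<omega> n) \<in> borel_measurable M) \<and>
     (\<forall>n C B. C \<in> sets (PiM {..<n} (\<lambda>_. borel)) \<longrightarrow> B \<in> sets borel \<longrightarrow>
        (let A = {\<omega>\<in>space M. (\<lambda>i\<in>{..<n}. P \<omega> i) \<in> C} in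
          measure M (A \<inter> {\<omega>\<in>space M. P \<omega> n \<in> B}) =
          (\<integral>\<omega>\<in>A. measure lborel (B \<inter> Kn (P \<omega>) n) / measure lborel (Kn (P \<omega>) n) \<partial>M)))"

end

theory Submission
  imports Defs
begin

text \<open>
  Let \<open>v i\<close> be the vertices and \<open>m i\<close> the largest \<open>x \<bullet> v i\<close> over the points chosen so far (and the
  origin). Then \<open>K\<^sub>n\<close> is cut out by \<open>x \<bullet> v i \<ge> m i - rho5\<close>, none of its five edges ever degenerates, and
  its \<open>i\<close>th height is \<open>rho5 + gap i m\<close> with \<open>gap i m = 1 - m i - gr * (m (i + 2) + m (i + 3))\<close>. Gaps
  decrease. A point changes the polygon only if it falls into an open cap, i.e. a corner of height
  \<open>gap i m > 0\<close> at the \<open>i\<close>th vertex; it moves the opposite edge and lowers \<open>gap i\<close>, \<open>gap (i + 2)\<close> and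
  \<open>gap (i + 3)\<close>, and the \<open>i\<close>th cap stays open. Hence some cap stays open forever.

  An open cap has area comparable to the square of its gap, so by Borel--Cantelli no gap stays above
  a positive constant, and almost surely no gap ever equals \<open>0\<close>. Translation invariance gives
  linear relations between the five gaps, by which two or more zeros in the limit are possible only for
  a pair \<open>i, i + 2\<close> or for all five. In both cases every cap that stays open is coupled to another one,
  and among the hits on open caps a positive fraction closes a cap directly (if two coupled gaps
  are of different size) or prepares such a closure (otherwise). A bounded potential then shows that the expected
  number of hits is finite, so the gaps would be eventually constant and positive, a contradiction.
\<close>

section \<open>The pentagon as an intersection of half-planes\<close>

declare One_nat_def [simp del] add_2_eq_Suc [simp del] add_2_eq_Suc' [simp del]

text \<open>\<open>gr\<close> is the inverse golden ratio \<open>2 * cos (2 * pi / 5)\<close>.\<close>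
definition gr :: real where "gr = 2 * rho5 - 1"

lemma rho5_pos: "0 < rho5"
  unfolding rho5_def by (rule cos_gt_zero_pi) (use pi_gt_zero in linarith)+

text \<open>The identity \<open>cos (3 * a) = - cos (2 * a)\<close> at \<open>a = pi / 5\<close> is
  a cubic equation for \<open>rho5\<close>; its factor \<open>rho5 + 1\<close> is positive and can
  be divided out.\<close>

lemma rho5_quadratic: "4 * rho5^2 = 2 * rho5 + 1"
proof -
  have "cos (3 * (pi/5)) = - cos (2 * (pi/5))"
  proof -
    have "cos (3 * (pi/5)) = cos (pi - 2 * (pi/5))" by (rule arg_cong[where f=cos]) simp
    thus ?thesis by (simp only: cos_pi_minus)
  qed
  hence "4 * rho5^3 - 3 * rho5 = - (2 * rho5^2 - 1)"
    unfolding rho5_def by (simp only: cos_treble_cos cos_double_cos)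
  hence "(rho5 + 1) * (4 * rho5^2 - 2 * rho5 - 1) = 0"
    by (simp add: algebra_simps power2_eq_square power3_eq_cube)
  thus ?thesis using rho5_pos by simp
qed

lemma gr_sq: "gr * gr = 1 - gr"
  using rho5_quadratic by (simp add: gr_def algebra_simps power2_eq_square)

lemma rho5_gr: "rho5 = (1 + gr) / 2"
  by (simp add: gr_def)

text \<open>Both bounds come from \<open>gr * (1 + gr) = 1\<close>. The precision matters later:
  \<open>9/10 * gr\<close> has to exceed \<open>11/20\<close>, and \<open>1 - gr\<close> has to
  exceed \<open>38/100\<close>.\<close>

lemma gr_bounds: "0.618 < gr" "gr < 0.6181"
proof -
  have p: "0 < 1 + gr" using rho5_pos by (simp add: gr_def)
  show "0.618 < gr"
  proof (rule ccontr)
    assume "\<not> 0.618 < gr"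
    hence "(1 + gr) * (0.618 - gr) \<ge> 0" using p by simp
    thus False using gr_sq \<open>\<not> 0.618 < gr\<close> by (simp add: algebra_simps)
  qed
  show "gr < 0.6181"
  proof (rule ccontr)
    assume "\<not> gr < 0.6181"
    hence "(1 + gr) * (gr - 0.6181) \<ge> 0" using p by simp
    thus False using gr_sq \<open>\<not> gr < 0.6181\<close> by (simp add: algebra_simps)
  qed
qed

text \<open>As a rewrite rule this reduces polynomials in \<open>gr\<close> to expressions linear in
  \<open>gr\<close>, which leaves linear arithmetic.\<close>

lemma gr_mult: "gr * (gr * x) = x - gr * x"
  using gr_sq by (metis left_diff_distrib mult.assoc mult_1)

lemma pent_vertex_add5: "pent_vertex (i + 5) = pent_vertex i"
proof -
  have "2 * pi * real (i + 5) / 5 = 2 * pi * real i / 5 + 2 * pi" by (simp add: field_simps)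
  thus ?thesis unfolding pent_vertex_def by (simp only: sin_periodic cos_periodic)
qed

lemma cos_pi5: "cos (2 * pi / 5) = gr / 2" "cos (4 * pi / 5) = - rho5"
proof -
  have a: "cos (2 * pi / 5) = 2 * rho5^2 - 1"
    using cos_double_cos[of "pi/5"] by (simp add: rho5_def)
  show "cos (2 * pi / 5) = gr / 2" unfolding a gr_def using rho5_quadratic by simp
  have "cos (4 * pi / 5) = cos (pi - pi / 5)" by (rule arg_cong[where f=cos]) simp
  thus "cos (4 * pi / 5) = - rho5" by (simp only: cos_pi_minus rho5_def)
qed

text \<open>Rotating a vector by an angle in both directions and adding gives twice the cosine of
  the angle times the vector. Here the angle is \<open>2 * pi / 5\<close>, in
  \<open>pent_vertex_sum23\<close> it is \<open>4 * pi / 5\<close>.\<close>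

lemma pent_vertex_sum14: "pent_vertex (i + 1) + pent_vertex (i + 4) = gr *\<^sub>R pent_vertex i"
proof -
  define t where "t = 2 * pi * real i / 5"
  have "2 * pi * real (i + 1) / 5 = t + 2 * pi / 5"
    "2 * pi * real (i + 4) / 5 = t - 2 * pi / 5 + 2 * pi" by (simp_all add: t_def field_simps)
  thus ?thesis unfolding pent_vertex_def t_def[symmetric]
    by (simp only: sin_periodic cos_periodic) (simp add: sin_add cos_add sin_diff cos_diff cos_pi5)
qed

lemma pent_vertex_sum23: "pent_vertex (i + 2) + pent_vertex (i + 3) = (- 2 * rho5) *\<^sub>R pent_vertex i"
proof -
  define t where "t = 2 * pi * real i / 5"
  have "2 * pi * real (i + 2) / 5 = t + 4 * pi / 5"
    "2 * pi * real (i + 3) / 5 = t - 4 * pi / 5 + 2 * pi" by (simp_all add: t_def field_simps)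
  thus ?thesis unfolding pent_vertex_def t_def[symmetric]
    by (simp only: sin_periodic cos_periodic) (simp add: sin_add cos_add sin_diff cos_diff cos_pi5)
qed

lemma inner_pent_sum14: "x \<bullet> pent_vertex (i + 1) + x \<bullet> pent_vertex (i + 4) = gr * (x \<bullet> pent_vertex i)"
  by (metis inner_add_right inner_scaleR_right pent_vertex_sum14)

text \<open>This is \<open>pent_vertex_sum23\<close> solved for the \<open>i\<close>th product, as
  \<open>2 * rho5\<close> and \<open>gr\<close> are inverse to each other. The negative coefficient
  turns lower bounds at two edges into an upper bound towards the vertex where they meet.\<close>

lemma inner_pent_sum23: "x \<bullet> pent_vertex i = - gr * (x \<bullet> pent_vertex (i + 2) + x \<bullet> pent_vertex (i + 3))"
proof -
  have "x \<bullet> pent_vertex (i + 2) + x \<bullet> pent_vertex (i + 3) = - 2 * rho5 * (x \<bullet> pent_vertex i)"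
    by (metis inner_add_right inner_scaleR_right pent_vertex_sum23)
  hence "- gr * (x \<bullet> pent_vertex (i + 2) + x \<bullet> pent_vertex (i + 3)) = - gr * (- 2 * rho5 * (x \<bullet> pent_vertex i))"
    by (simp only:)
  also have "\<dots> = (gr + gr * gr) * (x \<bullet> pent_vertex i)"
    unfolding rho5_gr by (simp add: field_simps)
  finally have "- gr * (x \<bullet> pent_vertex (i + 2) + x \<bullet> pent_vertex (i + 3)) = (gr + gr * gr) * (x \<bullet> pent_vertex i)" .
  thus ?thesis by (simp add: gr_sq)
qed

lemma inner_pent_pent:
  "pent_vertex i \<bullet> pent_vertex i = 1"
  "pent_vertex i \<bullet> pent_vertex (i + 1) = gr / 2"
  "pent_vertex i \<bullet> pent_vertex (i + 2) = - rho5"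
  "pent_vertex i \<bullet> pent_vertex (i + 3) = - rho5"
proof -
  define t where "t = 2 * pi * real i / 5"
  have d: "sin a * sin b + cos a * cos b = cos (b - a)" for a b :: real by (simp add: cos_diff)
  have e: "cos (6 * pi / 5) = - rho5"
  proof -
    have "cos (6 * pi / 5) = cos (pi / 5 + pi)" by (rule arg_cong[where f=cos]) simp
    thus ?thesis by (simp only: cos_periodic_pi rho5_def)
  qed
  show "pent_vertex i \<bullet> pent_vertex i = 1"
    by (simp add: pent_vertex_def inner_prod_def d)
  have "2 * pi * real (i + 1) / 5 = t + 2 * pi / 5" "2 * pi * real (i + 2) / 5 = t + 4 * pi / 5"
    "2 * pi * real (i + 3) / 5 = t + 6 * pi / 5" by (simp_all add: t_def field_simps)
  thus "pent_vertex i \<bullet> pent_vertex (i + 1) = gr / 2"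
    "pent_vertex i \<bullet> pent_vertex (i + 2) = - rho5"
    "pent_vertex i \<bullet> pent_vertex (i + 3) = - rho5"
    by (simp_all only: pent_vertex_def t_def[symmetric] inner_prod_def fst_conv snd_conv inner_real_def d add_diff_cancel_left' cos_pi5 e)
qed

text \<open>Indices range over all of \<open>nat\<close> with period 5, so that \<open>i + 2\<close>
  and \<open>i + 3\<close> need no reduction; this is the passage to residues.\<close>

lemma all_shift5: assumes "\<And>i. Q (i + 5) = Q i" shows "Q (i mod 5) = Q (i::nat)"
proof -
  have "Q (k + 5 * n) = Q k" for k n
  proof (induction n)
    case (Suc n)
    thus ?case using assms[of "k + 5 * n"] by (simp add: algebra_simps)
  qed simp
  from this[of "i mod 5" "i div 5"] show ?thesis by simp
qed

lemma pent_vertex_mod5: "pent_vertex (i mod 5) = pent_vertex i"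
  by (rule all_shift5) (rule pent_vertex_add5)

lemma all_shift5_iff:
  assumes "\<And>i. Q (i + 5) = Q (i::nat)"
  shows "(\<forall>k. Q k) \<longleftrightarrow> Q i \<and> Q (i + 1) \<and> Q (i + 2) \<and> Q (i + 3) \<and> Q (i + 4)"
proof (intro iffI allI)
  fix k assume h: "Q i \<and> Q (i + 1) \<and> Q (i + 2) \<and> Q (i + 3) \<and> Q (i + 4)"
  \<comment> \<open>Modulo 5, \<open>4 * i\<close> is \<open>- i\<close>, so \<open>e\<close> is the
    offset from \<open>i\<close> to \<open>k\<close>.\<close>
  define e where "e = (k + 4 * i) mod 5"
  have "e < 5" by (simp add: e_def)
  hence "e = 0 \<or> e = 1 \<or> e = 2 \<or> e = 3 \<or> e = 4" by auto
  hence q: "Q (i + e)" using h by auto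
  have "Q ((i + e) mod 5) = Q (i + e)" by (rule all_shift5) (rule assms)
  moreover have "(i + e) mod 5 = k mod 5" unfolding e_def by presburger
  moreover have "Q (k mod 5) = Q k" by (rule all_shift5) (rule assms)
  ultimately show "Q k" using q by simp
qed auto

lemma inner_pent_rec: "x \<bullet> pent_vertex (i + 2) = gr * (x \<bullet> pent_vertex (i + 1)) - x \<bullet> pent_vertex i"
  using inner_pent_sum14[of x "i + 1"] pent_vertex_add5[of i] by (simp add: add.assoc)

lemma inner_pent_neighbours:
  "x \<bullet> pent_vertex (i + 1) = gr * (x \<bullet> pent_vertex (i + 2)) - x \<bullet> pent_vertex (i + 3)"
  "x \<bullet> pent_vertex (i + 4) = gr * (x \<bullet> pent_vertex (i + 3)) - x \<bullet> pent_vertex (i + 2)"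
  using inner_pent_rec[of x "i + 1"] inner_pent_rec[of x "i + 2"] by (simp_all add: add.assoc)

text \<open>Two products determine the other three by the linear relations, and vertices 0 and 1 are
  linearly independent because \<open>sin (2 * pi / 5)\<close> is positive.\<close>

lemma inner_pent_ext:
  assumes "x \<bullet> pent_vertex (i + 2) = z \<bullet> pent_vertex (i + 2)"
    and "x \<bullet> pent_vertex (i + 3) = z \<bullet> pent_vertex (i + 3)"
  shows "x = z"
proof -
  define d where "d = x - z"
  have a: "d \<bullet> pent_vertex (i + 2) = 0" "d \<bullet> pent_vertex (i + 3) = 0"
    using assms by (simp_all add: d_def inner_diff_left)
  have "\<forall>k. d \<bullet> pent_vertex k = 0"
    by (subst all_shift5_iff[of _ i])
       (use a inner_pent_neighbours[of d i] inner_pent_sum23[of d i] in \<open>simp_all add: pent_vertex_add5\<close>)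
  hence b: "d \<bullet> pent_vertex 0 = 0" "d \<bullet> pent_vertex 1 = 0" by auto
  have "sin (2 * pi / 5) > 0" by (rule sin_gt_zero) (use pi_gt_zero in linarith)+
  with b have "fst d = 0" "snd d = 0" by (auto simp: pent_vertex_def inner_prod_def)
  thus ?thesis by (simp add: d_def prod_eq_iff)
qed

text \<open>The witness solves the Gram system of the two unit vectors, with off-diagonal entry
  \<open>d\<close> and determinant \<open>1 - d * d\<close>.\<close>

lemma inner_pent_surj:
  obtains w where "w \<bullet> pent_vertex (i + 2) = a" "w \<bullet> pent_vertex (i + 3) = b"
proof -
  define d where "d = gr / 2"
  have "d * d = (1 - gr) / 4" using gr_sq by (simp add: d_def)
  hence nz: "1 - d * d \<noteq> 0" using gr_bounds by simp
  define w where "w = ((a - d * b) / (1 - d * d)) *\<^sub>R pent_vertex (i + 2)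
    + ((b - d * a) / (1 - d * d)) *\<^sub>R pent_vertex (i + 3)"
  have e: "pent_vertex (i + 2) \<bullet> pent_vertex (i + 3) = d" "pent_vertex (i + 3) \<bullet> pent_vertex (i + 2) = d"
    using inner_pent_pent(2)[of "i + 2"] by (simp_all add: d_def inner_commute add.assoc)
  have "w \<bullet> pent_vertex (i + 2) = (a - d * b) / (1 - d * d) + (b - d * a) / (1 - d * d) * d"
    by (simp only: w_def inner_add_left inner_scaleR_left e inner_pent_pent(1) mult_1_right)
  also have "\<dots> = a * (1 - d * d) / (1 - d * d)" by (simp only: add_divide_distrib[symmetric] times_divide_eq_left) (simp add: algebra_simps)
  finally have 1: "w \<bullet> pent_vertex (i + 2) = a" using nz by simp
  have "w \<bullet> pent_vertex (i + 3) = (a - d * b) / (1 - d * d) * d + (b - d * a) / (1 - d * d)"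
    by (simp only: w_def inner_add_left inner_scaleR_left e inner_pent_pent(1) mult_1_right)
  also have "\<dots> = b * (1 - d * d) / (1 - d * d)" by (simp only: add_divide_distrib[symmetric] times_divide_eq_left) (simp add: algebra_simps)
  finally have 2: "w \<bullet> pent_vertex (i + 3) = b" using nz by simp
  show ?thesis using that 1 2 by blast
qed

lemma inner_pent_lower: "- rho5 \<le> pent_vertex j \<bullet> pent_vertex i"
proof -
  have "\<forall>i. - rho5 \<le> pent_vertex j \<bullet> pent_vertex i"
  proof (subst all_shift5_iff[of _ j])
    have "pent_vertex j \<bullet> pent_vertex (j + 4) = gr / 2"
      using inner_pent_sum14[of "pent_vertex j" j] inner_pent_pent[of j] by simp
    thus "- rho5 \<le> pent_vertex j \<bullet> pent_vertex j \<and> - rho5 \<le> pent_vertex j \<bullet> pent_vertex (j + 1) \<and>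
      - rho5 \<le> pent_vertex j \<bullet> pent_vertex (j + 2) \<and> - rho5 \<le> pent_vertex j \<bullet> pent_vertex (j + 3) \<and>
      - rho5 \<le> pent_vertex j \<bullet> pent_vertex (j + 4)"
      using inner_pent_pent[of j] gr_bounds rho5_pos by auto
  qed (simp add: pent_vertex_add5)
  thus ?thesis by blast
qed

text \<open>For the harder inclusion choose \<open>j\<close> with the smallest product. Then
  \<open>x\<close> lies in the cone spanned by the vertices \<open>j + 2\<close> and
  \<open>j + 3\<close>, the inequality at \<open>j\<close> bounds the cone coordinates by
  \<open>s + t \<le> 1\<close>, and the origin is itself a convex combination of these two vertices
  and vertex \<open>j\<close>.\<close>

lemma pentK_halfplanes: "pentK = {x. \<forall>i. - rho5 \<le> x \<bullet> pent_vertex i}"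
proof
  have "convex {x. - rho5 \<le> x \<bullet> pent_vertex i}" for i
    using convex_halfspace_ge[of "-rho5" "pent_vertex i"] by (simp add: inner_commute)
  hence "convex (\<Inter>i. {x. - rho5 \<le> x \<bullet> pent_vertex i})" by (intro convex_INT) auto
  moreover have "(\<Inter>i. {x. - rho5 \<le> x \<bullet> pent_vertex i}) = {x. \<forall>i. - rho5 \<le> x \<bullet> pent_vertex i}" by auto
  ultimately show "pentK \<subseteq> {x. \<forall>i. - rho5 \<le> x \<bullet> pent_vertex i}"
    unfolding pentK_def by (intro hull_minimal) (auto intro: inner_pent_lower)
next
  show "{x. \<forall>i. - rho5 \<le> x \<bullet> pent_vertex i} \<subseteq> pentK"
  proof
    fix x assume "x \<in> {x. \<forall>i. - rho5 \<le> x \<bullet> pent_vertex i}"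
    hence x: "- rho5 \<le> x \<bullet> pent_vertex i" for i by auto
    define y where "y i = x \<bullet> pent_vertex i" for i
    have y5: "y (i mod 5) = y i" for i unfolding y_def by (simp add: pent_vertex_mod5)
    have "Min (y ` {..<5}) \<in> y ` {..<5}" by (rule Min_in) (auto simp: lessThan_empty_iff)
    then obtain j where "Min (y ` {..<5}) = y j" by auto
    hence j: "y j \<le> y i" if "i < 5" for i using Min_le[of "y ` {..<5}" "y i"] that by auto
    have jmin: "y j \<le> y i" for i using j[of "i mod 5"] y5[of i] by simp
    \<comment> \<open>If \<open>x\<close> is \<open>s\<close> times vertex \<open>j + 2\<close> plus
      \<open>t\<close> times vertex \<open>j + 3\<close>, then pairing with the difference of the
      vertices \<open>j + 1\<close> and \<open>j\<close> removes the second term and multiplies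
      \<open>s\<close> by \<open>gr / 2 + rho5\<close>, which is \<open>c\<close>; likewise
      \<open>t\<close> is found from vertex \<open>j + 4\<close>.\<close>
    define c where "c = gr + 1/2"
    have c: "c > 0" using gr_bounds by (simp add: c_def)
    define s t where "s = (y (j + 1) - y j) / c" and "t = (y (j + 4) - y j) / c"
    have st: "s \<ge> 0" "t \<ge> 0" using jmin c by (simp_all add: s_def t_def)
    have q: "pent_vertex (j + 2) \<bullet> pent_vertex (j + 3) = gr / 2" "pent_vertex (j + 3) \<bullet> pent_vertex (j + 2) = gr / 2"
      using inner_pent_pent(2)[of "j + 2"] by (simp_all add: inner_commute add.assoc)
    have r: "y (j + 1) = gr * y (j + 2) - y (j + 3)" "y (j + 4) = gr * y (j + 3) - y (j + 2)"
      "y j = - gr * (y (j + 2) + y (j + 3))"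
      unfolding y_def using inner_pent_neighbours[of x j] inner_pent_sum23[of x j] by simp_all
    have cs: "c * s = 2 * gr * y (j + 2) + (gr - 1) * y (j + 3)"
      "c * t = 2 * gr * y (j + 3) + (gr - 1) * y (j + 2)"
      unfolding s_def t_def r using c by (simp_all add: field_simps)
    have "c * (s + t * (gr/2)) = c * y (j + 2)" "c * (s * (gr/2) + t) = c * y (j + 3)"
    proof -
      have "c * (s + t * (gr/2)) = (c * s) + (c * t) * gr / 2" by (simp add: algebra_simps)
      also have "\<dots> = c * y (j + 2)" unfolding cs
        by (simp add: algebra_simps gr_mult c_def add_divide_distrib diff_divide_distrib)
      finally show "c * (s + t * (gr/2)) = c * y (j + 2)" .
      have "c * (s * (gr/2) + t) = (c * t) + (c * s) * gr / 2" by (simp add: algebra_simps)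
      also have "\<dots> = c * y (j + 3)" unfolding cs
        by (simp add: algebra_simps gr_mult c_def add_divide_distrib diff_divide_distrib)
      finally show "c * (s * (gr/2) + t) = c * y (j + 3)" .
    qed
    hence yst: "s + t * (gr/2) = y (j + 2)" "s * (gr/2) + t = y (j + 3)" using c by simp_all
    have xst: "x = s *\<^sub>R pent_vertex (j + 2) + t *\<^sub>R pent_vertex (j + 3)"
      by (rule inner_pent_ext[of _ j])
         (use yst in \<open>simp_all only: y_def[symmetric] inner_add_left inner_scaleR_left q inner_pent_pent(1) mult_1_right\<close>)
    have "y j = - rho5 * (s + t)"
    proof -
      have "y j = s * (pent_vertex (j + 2) \<bullet> pent_vertex j) + t * (pent_vertex (j + 3) \<bullet> pent_vertex j)"
        unfolding y_def by (subst xst) (simp only: inner_add_left inner_scaleR_left)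
      thus ?thesis using inner_pent_pent(3,4)[of j] by (simp add: inner_commute algebra_simps)
    qed
    hence "rho5 * (s + t) \<le> rho5 * 1" using x[of j] by (simp add: y_def)
    hence st1: "s + t \<le> 1" using rho5_pos by simp
    \<comment> \<open>The missing weight \<open>1 - s - t\<close> is spread over the vertices
      \<open>j + 2\<close>, \<open>j + 3\<close>, \<open>j\<close> in the ratio
      \<open>1 : 1 : 2 * rho5\<close>, a combination that sums to the zero vector.\<close>
    define r where "r = (1 - s - t) / (2 + 2 * rho5)"
    have r0: "r \<ge> 0" using st1 rho5_pos by (simp add: r_def)
    have r1: "r * (2 + 2 * rho5) = 1 - s - t" using rho5_pos by (simp add: r_def)
    have "x = (s + r) *\<^sub>R pent_vertex (j + 2) + (t + r) *\<^sub>R pent_vertex (j + 3) + (2 * rho5 * r) *\<^sub>R pent_vertex j"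
    proof -
      have "r *\<^sub>R (pent_vertex (j + 2) + pent_vertex (j + 3)) + (2 * rho5 * r) *\<^sub>R pent_vertex j = 0"
        unfolding pent_vertex_sum23 scaleR_scaleR scaleR_add_left[symmetric] by (simp add: mult.commute)
      hence "x = s *\<^sub>R pent_vertex (j + 2) + t *\<^sub>R pent_vertex (j + 3) +
        (r *\<^sub>R (pent_vertex (j + 2) + pent_vertex (j + 3)) + (2 * rho5 * r) *\<^sub>R pent_vertex j)"
        using xst by (simp only: add_0_right)
      thus ?thesis by (simp only: scaleR_add_left scaleR_add_right add_ac)
    qed
    moreover have "(s + r) + (t + r) + 2 * rho5 * r = 1" using r1 by (simp add: algebra_simps)
    ultimately have "x \<in> convex hull {pent_vertex (j + 2), pent_vertex (j + 3), pent_vertex j}"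
      unfolding convex_hull_3 using st r0 rho5_pos by (auto intro!: exI)
    moreover have "pent_vertex i \<in> pent_vertex ` {..<5}" for i
      by (rule image_eqI[of _ _ "i mod 5"]) (simp_all add: pent_vertex_mod5)
    ultimately show "x \<in> pentK" unfolding pentK_def
      by (meson hull_mono subsetD insert_subset empty_subsetI)
  qed
qed

section \<open>Pentagons with parallel edges and their caps\<close>

definition trim :: "(nat \<Rightarrow> real) \<Rightarrow> (real \<times> real) set" where
  "trim m = {x. \<forall>i. m i - rho5 \<le> x \<bullet> pent_vertex i}"

definition gap :: "nat \<Rightarrow> (nat \<Rightarrow> real) \<Rightarrow> real" where
  "gap i m = 1 - m i - gr * (m (i + 2) + m (i + 3))"

text \<open>The last inequality keeps edge \<open>i + 1\<close> from degenerating: the lines of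
  edges \<open>i\<close> and \<open>i + 2\<close> meet beyond it as soon as
  \<open>m i + m (i + 2) < gr + 1 / 2 + gr * m (i + 1)\<close>, and \<open>gr + 1 / 2\<close>
  exceeds 1 by a fixed margin.\<close>

definition admissible :: "(nat \<Rightarrow> real) \<Rightarrow> bool" where
  "admissible m \<longleftrightarrow> (\<forall>i. m (i + 5) = m i) \<and> (\<forall>i. 0 \<le> m i) \<and>
     (\<forall>i. m i + m (i + 2) \<le> 1 + gr * m (i + 1))"

definition cap :: "nat \<Rightarrow> real \<Rightarrow> (nat \<Rightarrow> real) \<Rightarrow> (real \<times> real) set" where
  "cap i t m = {x \<in> trim m. m i + gap i m - t \<le> x \<bullet> pent_vertex i}"

text \<open>The model of a cap, with its vertex moved to the origin and the other edges ignored. It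
  is homogeneous in \<open>t\<close>, so its area is a constant times \<open>t^2\<close>.\<close>

definition corner :: "nat \<Rightarrow> real \<Rightarrow> (real \<times> real) set" where
  "corner i t = {x. 0 \<le> x \<bullet> pent_vertex (i + 2) \<and> 0 \<le> x \<bullet> pent_vertex (i + 3) \<and> - t \<le> x \<bullet> pent_vertex i}"

lemma gr_rho5: "gr * rho5 = 1 / 2"
  by (simp add: rho5_gr algebra_simps gr_sq)

lemma admissibleD:
  assumes "admissible m"
  shows "m (i + 5) = m i" "0 \<le> m i" "m i + m (i + 2) \<le> 1 + gr * m (i + 1)"
  using assms by (auto simp: admissible_def)

lemma gap_add5: assumes "\<And>i. m (i + 5) = m i" shows "gap (i + 5) m = gap i m"
  using assms[of i] assms[of "i + 2"] assms[of "i + 3"] by (simp add: gap_def add.assoc)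

text \<open>A translation of the polygon changes the levels but not the gaps, so the five gaps vary
  in at most three dimensions; this is one of the resulting linear relations.\<close>

lemma gap_relation:
  assumes "\<And>i. m (i + 5) = m i"
  shows "gap i m - gap (i + 1) m = (1 + gr) * (gap (i + 2) m - gap (i + 4) m)"
  using assms[of i] assms[of "i + 1"] assms[of "i + 2"]
  by (simp add: gap_def add.assoc algebra_simps gr_mult)

text \<open>Equivalently \<open>gap i m \<ge> - gr\<close>, so the height
  \<open>rho5 + gap i m\<close> is at least \<open>(1 - gr) / 2\<close>. Add the conditions at
  \<open>i\<close> and \<open>i + 3\<close> and \<open>gr\<close> times the one at
  \<open>i + 4\<close>, then multiply by \<open>gr\<close>.\<close>

lemma admissible_edge_le:
  assumes "admissible m"
  shows "m i + gr * (m (i + 2) + m (i + 3)) \<le> 1 + gr"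
proof -
  note a = admissibleD[OF assms]
  have 1: "m i + m (i + 2) \<le> 1 + gr * m (i + 1)" by (rule a(3))
  have 2: "m (i + 3) + m i \<le> 1 + gr * m (i + 4)"
    using a(3)[of "i + 3"] a(1)[of i] by (simp add: add.assoc)
  have 3: "m (i + 4) + m (i + 1) \<le> 1 + gr * m i"
    using a(3)[of "i + 4"] a(1)[of i] a(1)[of "i + 1"] by (simp add: add.assoc)
  have 4: "gr * (m (i + 4) + m (i + 1)) \<le> gr * (1 + gr * m i)"
    using 3 gr_bounds by (intro mult_left_mono) auto
  have "(1 + gr) * m i + (m (i + 2) + m (i + 3)) \<le> 2 + gr"
    using 1 2 4 by (simp add: algebra_simps gr_mult)
  hence "gr * ((1 + gr) * m i + (m (i + 2) + m (i + 3))) \<le> gr * (2 + gr)"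
    using gr_bounds by (intro mult_left_mono) auto
  thus ?thesis by (simp add: algebra_simps gr_mult gr_sq)
qed

text \<open>The corner where the edges with inner normals \<open>v (i + 2)\<close> and \<open>v (i + 3)\<close> meet is the vertex
  of \<open>trim m\<close> in direction \<open>v i\<close>, and \<open>m i + gap i m\<close> is its level. Admissibility keeps the other three
  edges at a positive distance, uniformly in \<open>m\<close>.\<close>
lemma cap_eq_corner:
  assumes m: "admissible m"
    and w: "w \<bullet> pent_vertex (i + 2) = m (i + 2) - rho5" "w \<bullet> pent_vertex (i + 3) = m (i + 3) - rho5"
  shows "w \<bullet> pent_vertex i = m i + gap i m"
    and "cap i t m \<subseteq> (+) w ` corner i t"
    and "t \<le> 1 / 50 \<Longrightarrow> (+) w ` corner i t = cap i t m"
proof -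
  show wi: "w \<bullet> pent_vertex i = m i + gap i m"
    using inner_pent_sum23[of w i] unfolding w gap_def
    by (simp add: rho5_gr algebra_simps gr_sq add_divide_distrib)
  show sub: "cap i t m \<subseteq> (+) w ` corner i t"
  proof
    fix x assume "x \<in> cap i t m"
    hence "x - w \<in> corner i t"
      using w wi by (auto simp: cap_def trim_def corner_def inner_diff_left)
    thus "x \<in> (+) w ` corner i t" by (auto intro!: image_eqI[of _ _ "x - w"])
  qed
  assume t: "t \<le> 1 / 50"
  have "(+) w ` corner i t \<subseteq> cap i t m"
  proof
    fix x assume "x \<in> (+) w ` corner i t"
    then obtain y where y: "x = w + y" "0 \<le> y \<bullet> pent_vertex (i + 2)" "0 \<le> y \<bullet> pent_vertex (i + 3)"
      "- t \<le> y \<bullet> pent_vertex i" by (auto simp: corner_def)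
    \<comment> \<open>\<open>a\<close> and \<open>b\<close> are the distances of \<open>x\<close>
      from the two edges meeting in \<open>w\<close>; thickness at most \<open>1 / 50\<close> keeps
      their sum at most \<open>1 / 30\<close>.\<close>
    define a b where "a = y \<bullet> pent_vertex (i + 2)" and "b = y \<bullet> pent_vertex (i + 3)"
    have ab: "0 \<le> a" "0 \<le> b" "y \<bullet> pent_vertex i = - gr * (a + b)"
      using y inner_pent_sum23[of y i] by (auto simp: a_def b_def)
    have "gr * (a + b) \<le> 1 / 50" using ab y t by simp
    moreover have "0.618 * (a + b) \<le> gr * (a + b)" using ab gr_bounds by (intro mult_right_mono) auto
    ultimately have ab': "a + b \<le> 1/30" by simp
    have gab: "0 \<le> gr * a" "0 \<le> gr * b" using ab gr_bounds by simp_all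
    have x2: "x \<bullet> pent_vertex (i + 2) = m (i + 2) - rho5 + a"
      "x \<bullet> pent_vertex (i + 3) = m (i + 3) - rho5 + b"
      using w by (simp_all add: y a_def b_def inner_add_left)
    have xi: "x \<bullet> pent_vertex i = m i + gap i m - gr * (a + b)"
      using wi ab by (simp add: y inner_add_left)
    have e: "m i + gr * (m (i + 2) + m (i + 3)) \<le> 1 + gr" by (rule admissible_edge_le[OF m])
    have g0: "m i - rho5 \<le> x \<bullet> pent_vertex i"
    proof -
      have "m i - rho5 + gr * (a + b) \<le> m i + gap i m"
      proof -
        have "gr \<le> 7/10" using gr_bounds by simp
        moreover have "rho5 = 1/2 + gr/2" by (simp add: rho5_gr)
        ultimately show ?thesis using e \<open>gr * (a + b) \<le> 1/50\<close> unfolding gap_def by linarith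
      qed
      thus ?thesis using xi by linarith
    qed
    \<comment> \<open>Admissibility leaves a margin \<open>gr - 1 / 2 > 1 / 10\<close> at this edge,
      and likewise at edge \<open>i + 4\<close> below; the offset from the corner uses up at most
      \<open>1 / 30\<close> of it.\<close>
    have g1: "m (i + 1) - rho5 \<le> x \<bullet> pent_vertex (i + 1)"
    proof -
      have "x \<bullet> pent_vertex (i + 1) = gr * (m (i + 2) - rho5 + a) - (m (i + 3) - rho5 + b)"
        using inner_pent_neighbours(1)[of x i] x2 by simp
      also have "\<dots> = gr * m (i + 2) - m (i + 3) + gr * a - b + gr / 2"
        by (simp add: rho5_gr field_simps gr_sq)
      finally have "x \<bullet> pent_vertex (i + 1) = gr * m (i + 2) - m (i + 3) + gr * a - b + gr / 2" .
      moreover have "m (i + 1) + m (i + 3) \<le> 1 + gr * m (i + 2)"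
        using admissibleD(3)[OF m, of "i + 1"] by (simp add: add.assoc)
      moreover have "gr > 3/5" "rho5 = 1/2 + gr/2" using gr_bounds by (simp_all add: rho5_gr)
      ultimately show ?thesis using gab ab(1,2) ab' by linarith
    qed
    have g4: "m (i + 4) - rho5 \<le> x \<bullet> pent_vertex (i + 4)"
    proof -
      have "x \<bullet> pent_vertex (i + 4) = gr * (m (i + 3) - rho5 + b) - (m (i + 2) - rho5 + a)"
        using inner_pent_neighbours(2)[of x i] x2 by simp
      also have "\<dots> = gr * m (i + 3) - m (i + 2) + gr * b - a + gr / 2"
        by (simp add: rho5_gr field_simps gr_sq)
      finally have "x \<bullet> pent_vertex (i + 4) = gr * m (i + 3) - m (i + 2) + gr * b - a + gr / 2" .
      moreover have "m (i + 2) + m (i + 4) \<le> 1 + gr * m (i + 3)"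
        using admissibleD(3)[OF m, of "i + 2"] by (simp add: add.assoc)
      moreover have "gr > 3/5" "rho5 = 1/2 + gr/2" using gr_bounds by (simp_all add: rho5_gr)
      ultimately show ?thesis using gab ab(1,2) ab' by linarith
    qed
    have "x \<in> trim m" unfolding trim_def mem_Collect_eq
      by (subst all_shift5_iff[of _ i])
         (use g0 g1 g4 x2 ab in \<open>simp_all add: pent_vertex_add5 admissibleD(1)[OF m]\<close>)
    thus "x \<in> cap i t m" using xi ab(3) y(4) by (simp add: cap_def)
  qed
  with sub show "(+) w ` corner i t = cap i t m" by blast
qed

lemma trim_vertex:
  assumes "admissible m"
  obtains w where "w \<in> trim m" "w \<bullet> pent_vertex i = m i + gap i m"
    "w \<bullet> pent_vertex (i + 2) = m (i + 2) - rho5" "w \<bullet> pent_vertex (i + 3) = m (i + 3) - rho5"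
proof -
  obtain w where w: "w \<bullet> pent_vertex (i + 2) = m (i + 2) - rho5" "w \<bullet> pent_vertex (i + 3) = m (i + 3) - rho5"
    by (rule inner_pent_surj)
  have "0 \<in> corner i 0" by (simp add: corner_def)
  hence "w \<in> (+) w ` corner i 0" by force
  hence "w \<in> cap i 0 m" using cap_eq_corner(3)[OF assms w, of 0] by simp
  thus ?thesis using that[of w] w cap_eq_corner(1)[OF assms w] by (simp add: cap_def)
qed

lemma trim_inner_le: assumes "x \<in> trim m" shows "x \<bullet> pent_vertex i \<le> m i + gap i m"
proof -
  have "gr * ((m (i + 2) - rho5) + (m (i + 3) - rho5)) \<le> gr * (x \<bullet> pent_vertex (i + 2) + x \<bullet> pent_vertex (i + 3))"
    using assms gr_bounds by (intro mult_left_mono add_mono) (auto simp: trim_def)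
  thus ?thesis using inner_pent_sum23[of x i]
    by (simp add: gap_def rho5_gr algebra_simps gr_sq add_divide_distrib)
qed

lemma pent_height_trim:
  assumes m: "admissible m"
  shows "pent_height (trim m) i = rho5 + gap i m"
proof -
  obtain w where w: "w \<in> trim m" "w \<bullet> pent_vertex i = m i + gap i m" by (rule trim_vertex[OF m])
  \<comment> \<open>Modulo 5, \<open>i + 2 + 3\<close> is \<open>i\<close>, so the vertex in
    direction \<open>i + 2\<close> lies on edge \<open>i\<close>, where the minimum is
    attained.\<close>
  obtain u where u: "u \<in> trim m" "u \<bullet> pent_vertex (i + 2 + 3) = m (i + 2 + 3) - rho5"
    by (rule trim_vertex[OF m, of "i + 2"])
  have "pent_vertex (i + 2 + 3) = pent_vertex i" "m (i + 2 + 3) = m i"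
    using pent_vertex_add5[of i] admissibleD(1)[OF m, of i] by (simp_all add: add.assoc)
  hence u': "u \<bullet> pent_vertex i = m i - rho5" using u by simp
  have "(SUP x\<in>trim m. x \<bullet> pent_vertex i) = m i + gap i m"
    by (rule cSup_eq_maximum) (use w in \<open>force\<close>, use trim_inner_le in blast)
  moreover have "(INF x\<in>trim m. x \<bullet> pent_vertex i) = m i - rho5"
    by (rule cInf_eq_minimum) (use u u' in force, auto simp: trim_def)
  ultimately show ?thesis by (simp add: pent_height_def)
qed

text \<open>The vertices \<open>i\<close> and \<open>i + 1\<close> share edge \<open>i + 3\<close>,
  and this edge keeps the sum of the two products at least \<open>1 - 3/2 * gr > 2/50\<close> below
  the sum of the two vertex levels. For the cap at \<open>i + 2\<close>: a point near vertex
  \<open>i\<close> is within \<open>1 / 30\<close> of edge \<open>i + 2\<close>, whereas that cap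
  lies near the top of a height bounded below by \<open>admissible_edge_le\<close>.\<close>

lemma cap_disjoint:
  assumes m: "admissible m" and x: "x \<in> cap i (1/50) m"
  shows "x \<notin> cap (i + 1) (1/50) m" "x \<notin> cap (i + 2) (1/50) m"
proof -
  have xc: "m k - rho5 \<le> x \<bullet> pent_vertex k" for k using x by (simp add: cap_def trim_def)
  have xi: "m i + gap i m - 1/50 \<le> x \<bullet> pent_vertex i" using x by (simp add: cap_def)
  show "x \<notin> cap (i + 1) (1/50) m"
  proof
    assume "x \<in> cap (i + 1) (1/50) m"
    hence x1: "m (i + 1) + gap (i + 1) m - 1/50 \<le> x \<bullet> pent_vertex (i + 1)" by (simp add: cap_def)
    have "x \<bullet> pent_vertex i + x \<bullet> pent_vertex (i + 1) = - (1 + gr) * (x \<bullet> pent_vertex (i + 3))"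
      using inner_pent_neighbours(1)[of x i] inner_pent_sum23[of x i] by (simp add: algebra_simps)
    also have "\<dots> \<le> - (1 + gr) * (m (i + 3) - rho5)"
      using xc[of "i + 3"] gr_bounds by simp
    also have "\<dots> = 1 + gr / 2 - (1 + gr) * m (i + 3)"
      by (simp add: rho5_gr field_simps gr_sq)
    finally have up: "x \<bullet> pent_vertex i + x \<bullet> pent_vertex (i + 1) \<le> 1 + gr / 2 - (1 + gr) * m (i + 3)" .
    have lo: "m i + gap i m + (m (i + 1) + gap (i + 1) m) = 2 - gr * (m (i + 2) + m (i + 4)) - 2 * gr * m (i + 3)"
      by (simp add: gap_def add.assoc algebra_simps)
    have "gr * (m (i + 2) + m (i + 4)) \<le> gr * (1 + gr * m (i + 3))"
      using admissibleD(3)[OF m, of "i + 2"] gr_bounds by (intro mult_left_mono) (auto simp: add.assoc)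
    also have "\<dots> = gr + m (i + 3) - gr * m (i + 3)" by (simp add: algebra_simps gr_mult)
    finally show False using up lo xi x1 gr_bounds by (simp add: algebra_simps)
  qed
  show "x \<notin> cap (i + 2) (1/50) m"
  proof
    assume "x \<in> cap (i + 2) (1/50) m"
    hence x2: "m (i + 2) + gap (i + 2) m - 1/50 \<le> x \<bullet> pent_vertex (i + 2)" by (simp add: cap_def)
    define a where "a = x \<bullet> pent_vertex (i + 2) - (m (i + 2) - rho5)"
    have a0: "0 \<le> a" using xc by (simp add: a_def)
    have "gr * a \<le> 1/50"
    proof -
      define b where "b = x \<bullet> pent_vertex (i + 3) - (m (i + 3) - rho5)"
      have "x \<bullet> pent_vertex i = - gr * ((a + m (i + 2) - rho5) + (b + m (i + 3) - rho5))"
        unfolding a_def b_def using inner_pent_sum23[of x i] by simp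
      also have "\<dots> = m i + gap i m - gr * a - gr * b"
        using gr_rho5 by (simp add: gap_def algebra_simps)
      finally have "gr * a + gr * b \<le> 1/50" using xi by linarith
      moreover have "0 \<le> gr * b" using gr_bounds xc by (simp add: b_def)
      ultimately show ?thesis by linarith
    qed
    moreover have "0.618 * a \<le> gr * a" using a0 gr_bounds by (intro mult_right_mono) auto
    ultimately have "a \<le> 1/30" by simp
    moreover have "gr < 7/10" "rho5 = 1/2 + gr/2" using gr_bounds by (simp_all add: rho5_gr)
    ultimately show False using x2 admissible_edge_le[OF m, of "i + 2"]
      unfolding a_def gap_def by linarith
  qed
qed

lemma cap_disjoint_all:
  assumes m: "admissible m" and x: "x \<in> cap i (1/50) m" and y: "x \<in> cap k (1/50) m"
  shows "k mod 5 = i mod 5"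
proof -
  have s: "cap j (1/50) m = cap (j + 5) (1/50) m" for j
    using pent_vertex_add5[of j] gap_add5[of m j] admissibleD(1)[OF m] by (simp add: cap_def)
  have n: "x \<notin> cap (i + 3) (1/50) m" "x \<notin> cap (i + 4) (1/50) m"
    using cap_disjoint[OF m, of x "i + 3"] cap_disjoint[OF m, of x "i + 4"] x s[of i] by (auto simp: add.assoc)
  have "\<forall>k. x \<in> cap k (1/50) m \<longrightarrow> k mod 5 = i mod 5"
    by (subst all_shift5_iff[of _ i]) (use n cap_disjoint[OF m x] s in auto)
  thus ?thesis using y by blast
qed

section \<open>Areas of corners and caps\<close>

lemma closed_corner: "closed (corner i t)"
proof -
  have "corner i t = {x. 0 \<le> x \<bullet> pent_vertex (i + 2)} \<inter> {x. 0 \<le> x \<bullet> pent_vertex (i + 3)} \<inter> {x. - t \<le> x \<bullet> pent_vertex i}"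
    by (auto simp: corner_def)
  thus ?thesis by (auto intro!: closed_Int closed_Collect_le continuous_intros)
qed

lemma closed_trim: "closed (trim m)"
proof -
  have "trim m = (\<Inter>i. {x. m i - rho5 \<le> x \<bullet> pent_vertex i})" by (auto simp: trim_def)
  thus ?thesis by (auto intro!: closed_INT closed_Collect_le continuous_intros)
qed

lemma pentK_eq_trim: "pentK = trim (\<lambda>_. 0)"
  by (simp add: pentK_halfplanes trim_def)

lemma emeasure_pentK_finite: "emeasure lborel pentK < \<infinity>"
proof -
  have "compact pentK" unfolding pentK_def by (intro compact_convex_hull finite_imp_compact) auto
  thus ?thesis by (intro emeasure_bounded_finite compact_imp_bounded)
qed

lemma emeasure_lborel_affine:
  fixes S :: "(real \<times> real) set"
  assumes "S \<in> sets borel"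
  shows "emeasure lborel ((\<lambda>x. m *\<^sub>R x + w) ` S) = ennreal (m^2) * emeasure lborel S"
proof (cases "m = 0")
  case True
  have "(\<lambda>x. m *\<^sub>R x + w) ` S \<subseteq> {w}" using True by auto
  hence "countable ((\<lambda>x. m *\<^sub>R x + w) ` S)" by (rule countable_subset) simp
  thus ?thesis using True by (simp add: emeasure_lborel_countable)
next
  case False
  \<comment> \<open>As a preimage under a continuous map the image is Borel, and on Borel sets
    completed Lebesgue measure agrees with \<open>lborel\<close>.\<close>
  have e: "(\<lambda>x. m *\<^sub>R x + w) ` S = (\<lambda>x. (1/m) *\<^sub>R (x - w)) -` S"
  proof (intro equalityI subsetI)
    fix x assume "x \<in> (\<lambda>x. (1/m) *\<^sub>R (x - w)) -` S"
    thus "x \<in> (\<lambda>x. m *\<^sub>R x + w) ` S" using False by (intro image_eqI[of _ _ "(1/m) *\<^sub>R (x - w)"]) auto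
  qed (use False in auto)
  have "(\<lambda>x. (1/m) *\<^sub>R (x - w)) \<in> borel_measurable borel" by measurable
  from measurable_sets[OF this assms]
  have "(\<lambda>x. m *\<^sub>R x + w) ` S \<in> sets borel" unfolding e by simp
  moreover have "emeasure lebesgue T = emeasure lborel T" if "T \<in> sets borel" for T :: "(real \<times> real) set"
    using that by (simp add: emeasure_completion)
  moreover have "DIM(real \<times> real) = 2" by simp
  ultimately show ?thesis using emeasure_lebesgue_affine[of m w S] assms
    by (simp only: power2_abs)
qed

lemma emeasure_corner:
  assumes "0 \<le> t"
  shows "emeasure lborel ((+) w ` corner i t) = ennreal (t^2) * emeasure lborel (corner i 1)"
proof (cases "t = 0")
  case True
  have "x = 0" if "x \<in> corner i 0" for x
  proof -
    have "gr * (x \<bullet> pent_vertex (i + 2) + x \<bullet> pent_vertex (i + 3)) \<le> 0"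
      using that inner_pent_sum23[of x i] by (simp add: corner_def)
    hence "x \<bullet> pent_vertex (i + 2) + x \<bullet> pent_vertex (i + 3) \<le> 0"
      using gr_bounds by (simp add: mult_le_0_iff)
    thus "x = 0" using that by (intro inner_pent_ext[of _ i]) (auto simp: corner_def)
  qed
  hence "(+) w ` corner i t \<subseteq> {w}" using True by auto
  hence "countable ((+) w ` corner i t)" by (rule countable_subset) simp
  thus ?thesis using True by (simp add: emeasure_lborel_countable)
next
  case False
  hence t: "t > 0" using assms by simp
  have "(+) w ` corner i t = (\<lambda>x. t *\<^sub>R x + w) ` corner i 1"
  proof -
    have "corner i t = (\<lambda>x. t *\<^sub>R x) ` corner i 1"
    proof (intro equalityI subsetI)
      fix x assume "x \<in> corner i t"
      hence "(1/t) *\<^sub>R x \<in> corner i 1" using t by (simp add: corner_def field_simps)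
      thus "x \<in> (\<lambda>x. t *\<^sub>R x) ` corner i 1" using t by (intro image_eqI[of _ _ "(1/t) *\<^sub>R x"]) auto
    next
      fix x assume "x \<in> (\<lambda>x. t *\<^sub>R x) ` corner i 1"
      then obtain y where "x = t *\<^sub>R y" "y \<in> corner i 1" by auto
      thus "x \<in> corner i t" using t mult_left_mono[of "-1" "y \<bullet> pent_vertex i" t] by (simp add: corner_def)
    qed
    thus ?thesis by (auto simp: image_image add.commute)
  qed
  thus ?thesis using emeasure_lborel_affine[of "corner i 1" t w] closed_corner by auto
qed

lemma emeasure_corner_pos: "0 < emeasure lborel (corner i 1)"
proof -
  define U where "U = {x::real \<times> real. 0 < x \<bullet> pent_vertex (i + 2)} \<inter> {x. 0 < x \<bullet> pent_vertex (i + 3)} \<inter> {x. - 1 < x \<bullet> pent_vertex i}"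
  have "open U" unfolding U_def by (intro open_Int open_Collect_less continuous_intros)
  moreover have "(- 1/2) *\<^sub>R pent_vertex i \<in> U" using inner_pent_pent[of i] rho5_pos by (simp add: U_def)
  ultimately have "\<not> negligible U" using open_not_negligible by blast
  hence "emeasure lebesgue U \<noteq> 0" using \<open>open U\<close> by (auto simp: negligible_iff_null_sets null_sets_def)
  moreover have "U \<in> sets borel" using \<open>open U\<close> by simp
  ultimately have "0 < emeasure lborel U" by (simp add: emeasure_completion zero_less_iff_neq_zero)
  also have "\<dots> \<le> emeasure lborel (corner i 1)"
    by (rule emeasure_mono) (use closed_corner in \<open>auto simp: U_def corner_def less_imp_le\<close>)
  finally show ?thesis .
qed

text \<open>A translate of the corner of size \<open>1 / 50\<close> is a cap of the initial
  pentagon, hence of finite area; quadratic scaling carries this to size 1.\<close>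

lemma emeasure_corner_finite: "emeasure lborel (corner i 1) < \<infinity>"
proof -
  have z: "admissible (\<lambda>_. 0)" using gr_bounds by (simp add: admissible_def)
  obtain w where w: "w \<bullet> pent_vertex (i + 2) = 0 - rho5" "w \<bullet> pent_vertex (i + 3) = 0 - rho5"
    by (rule inner_pent_surj)
  have "(+) w ` corner i (1/50) = cap i (1/50) (\<lambda>_. 0)"
    by (rule cap_eq_corner(3)[OF z]) (use w in auto)
  also have "\<dots> \<subseteq> pentK" by (auto simp: cap_def pentK_eq_trim)
  finally have "emeasure lborel ((+) w ` corner i (1/50)) \<le> emeasure lborel pentK"
    by (rule emeasure_mono) (simp add: pentK_eq_trim closed_trim)
  hence "ennreal ((1/50)^2) * emeasure lborel (corner i 1) < \<infinity>"
    using emeasure_pentK_finite emeasure_corner[of "1/50" w i] by (simp add: le_less_trans)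
  thus ?thesis by (auto simp: ennreal_mult_less_top)
qed

text \<open>The constants are the extreme areas of the five unit corners and so do not depend on the
  polygon. A cap always lies in its corner, which gives the upper bound; it is the whole corner for
  \<open>t \<le> 1/50\<close>, which gives the lower bound.\<close>

lemma cap_area_bounds:
  obtains a b where "0 < a" "0 < b"
    "\<And>i m t. admissible m \<Longrightarrow> 0 \<le> t \<Longrightarrow> emeasure lborel (cap i t m) \<le> ennreal (b * t^2)"
    "\<And>i m t. admissible m \<Longrightarrow> 0 \<le> t \<Longrightarrow> t \<le> 1/50 \<Longrightarrow> ennreal (a * t^2) \<le> emeasure lborel (cap i t m)"
proof -
  define k where "k i = measure lborel (corner i 1)" for i
  have ek: "emeasure lborel (corner i 1) = ennreal (k i)" for i
    using emeasure_corner_finite[of i] by (simp add: k_def emeasure_eq_ennreal_measure)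
  have kpos: "0 < k i" for i using emeasure_corner_pos[of i] by (simp add: ek)
  have "k (i + 5) = k i" for i
  proof -
    have "corner (i + 5) 1 = corner i 1"
      using pent_vertex_add5[of i] pent_vertex_add5[of "i + 2"] pent_vertex_add5[of "i + 3"]
      by (simp add: corner_def add.assoc)
    thus ?thesis by (simp add: k_def)
  qed
  hence k5: "k i \<in> k ` {..<5}" for i
    using all_shift5[of k i] by (intro image_eqI[of _ _ "i mod 5"]) auto
  define a b where "a = Min (k ` {..<5})" and "b = Max (k ` {..<5})"
  have fin: "finite (k ` {..<5})" by simp
  have ab: "a \<le> k i" "k i \<le> b" for i
    unfolding a_def b_def using k5[of i] fin by auto
  have a: "0 < a" unfolding a_def using kpos by (subst Min_gr_iff) (auto simp: lessThan_empty_iff)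
  have b: "0 < b" using ab(2)[of 0] kpos[of 0] by linarith
  show ?thesis
  proof (rule that[OF a b])
    fix i m and t :: real assume m: "admissible m" and t: "0 \<le> t"
    obtain w where w: "w \<bullet> pent_vertex (i + 2) = m (i + 2) - rho5" "w \<bullet> pent_vertex (i + 3) = m (i + 3) - rho5"
      by (rule inner_pent_surj)
    have cs: "closed ((+) w ` corner i t)" using closed_corner by (rule closed_translation)
    have ec: "emeasure lborel ((+) w ` corner i t) = ennreal (k i * t^2)"
      using emeasure_corner[OF t, of w i] kpos[of i] by (simp add: ek ennreal_mult mult.commute)
    have "emeasure lborel (cap i t m) \<le> emeasure lborel ((+) w ` corner i t)"
      using cap_eq_corner(2)[OF m w] cs by (intro emeasure_mono) auto
    also have "\<dots> \<le> ennreal (b * t^2)" unfolding ec using ab by (intro ennreal_leI mult_right_mono) auto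
    finally show "emeasure lborel (cap i t m) \<le> ennreal (b * t^2)" .
    assume "t \<le> 1/50"
    hence "emeasure lborel (cap i t m) = ennreal (k i * t^2)" using ec cap_eq_corner(3)[OF m w] by simp
    thus "ennreal (a * t^2) \<le> emeasure lborel (cap i t m)"
      using ab by (auto intro!: ennreal_leI mult_right_mono)
  qed
qed

section \<open>The law of the process\<close>

definition step :: "(nat \<Rightarrow> real) \<Rightarrow> real \<times> real \<Rightarrow> nat \<Rightarrow> real" where
  "step m x = (\<lambda>i. max (m i) (x \<bullet> pent_vertex i))"

primrec level :: "(nat \<Rightarrow> real \<times> real) \<Rightarrow> nat \<Rightarrow> nat \<Rightarrow> real" where
  "level p 0 = (\<lambda>i. 0)"
| "level p (Suc n) = step (level p n) (p n)"

lemma trim_step: "trim (step m x) = trim m \<inter> (\<lambda>y. x + y) ` pentK"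
proof -
  have "y \<in> (\<lambda>y. x + y) ` pentK \<longleftrightarrow> (\<forall>i. x \<bullet> pent_vertex i - rho5 \<le> y \<bullet> pent_vertex i)" for y
  proof
    assume "\<forall>i. x \<bullet> pent_vertex i - rho5 \<le> y \<bullet> pent_vertex i"
    hence "y - x \<in> pentK" by (auto simp: pentK_halfplanes inner_diff_left algebra_simps)
    thus "y \<in> (\<lambda>y. x + y) ` pentK" by (intro image_eqI[of _ _ "y - x"]) auto
  qed (auto simp: pentK_halfplanes inner_add_left)
  moreover have "y \<in> trim (step m x) \<longleftrightarrow>
      y \<in> trim m \<and> (\<forall>i. x \<bullet> pent_vertex i - rho5 \<le> y \<bullet> pent_vertex i)" for y
    by (auto simp: trim_def step_def diff_le_eq)
  ultimately show ?thesis by blast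
qed

lemma Kn_eq_trim: "Kn p n = trim (level p n)"
proof (induction n)
  case 0
  thus ?case by (simp add: Kn_def pentK_eq_trim)
next
  case (Suc n)
  have "Kn p (Suc n) = Kn p n \<inter> (\<lambda>x. p n + x) ` pentK"
    unfolding Kn_def by (auto simp: less_Suc_eq)
  thus ?case using Suc by (simp add: trim_step)
qed

lemma level_cong: "(\<And>k. k < n \<Longrightarrow> p k = q k) \<Longrightarrow> level p n = level q n"
  by (induction n) auto

lemma measurable_level [measurable]:
  "(\<lambda>h. level h n) \<in> PiM {..<n} (\<lambda>_. borel) \<rightarrow>\<^sub>M PiM UNIV (\<lambda>_. borel)"
proof -
  have "(\<lambda>h. level h k i) \<in> borel_measurable (PiM {..<n} (\<lambda>_. borel))" if "k \<le> n" for k i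
    using that
  proof (induction k)
    case (Suc k)
    have [measurable]: "(\<lambda>h. h k) \<in> PiM {..<n} (\<lambda>_. borel) \<rightarrow>\<^sub>M (borel :: (real \<times> real) measure)"
      by (rule measurable_component_singleton) (use Suc in auto)
    have [measurable]: "(\<lambda>h. level h k i) \<in> borel_measurable (PiM {..<n} (\<lambda>_. borel))"
      using Suc by auto
    show ?case by (simp add: step_def)
  qed simp
  thus ?thesis by (intro measurable_PiM_single') auto
qed

lemma measurable_pred_trim [measurable]:
  "Measurable.pred (PiM UNIV (\<lambda>_. borel) \<Otimes>\<^sub>M borel) (\<lambda>z. snd z \<in> trim (fst z))"
proof -
  have [measurable]: "(\<lambda>z. fst z i) \<in> borel_measurable (PiM UNIV (\<lambda>_. borel) \<Otimes>\<^sub>M (borel :: (real \<times> real) measure))"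
    for i :: nat
    by (rule measurable_compose[OF measurable_fst measurable_component_singleton]) simp
  show ?thesis unfolding trim_def mem_Collect_eq by measurable
qed

section \<open>The process and the joint law of its history and next point\<close>

locale pent_process =
  fixes M :: "'a measure" and P :: "'a \<Rightarrow> nat \<Rightarrow> real \<times> real"
  assumes process: "pentagon_process M P"
begin

sublocale prob_space M
  using process by (simp add: pentagon_process_def)

lemma measurable_P [measurable]: "(\<lambda>\<omega>. P \<omega> n) \<in> borel_measurable M"
  using process by (simp add: pentagon_process_def)

definition past :: "nat \<Rightarrow> 'a \<Rightarrow> nat \<Rightarrow> real \<times> real" where
  "past n \<omega> = (\<lambda>i\<in>{..<n}. P \<omega> i)"

lemma measurable_past [measurable]: "past n \<in> M \<rightarrow>\<^sub>M PiM {..<n} (\<lambda>_. borel)"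
  unfolding past_def by (intro measurable_restrict measurable_P)

lemma level_past [simp]: "level (past n \<omega>) n = level (P \<omega>) n"
  by (rule level_cong) (simp add: past_def)

lemma measurable_level_P [measurable]: "(\<lambda>\<omega>. level (P \<omega>) n) \<in> M \<rightarrow>\<^sub>M PiM UNIV (\<lambda>_. borel)"
  using measurable_compose[OF measurable_past[of n] measurable_level[of n]] by simp

lemma measurable_area [measurable]:
  assumes "D \<in> sets (PiM {..<n} (\<lambda>_. borel) \<Otimes>\<^sub>M borel)"
  shows "(\<lambda>h. emeasure lborel {x \<in> trim (level h n). (h, x) \<in> D}) \<in> borel_measurable (PiM {..<n} (\<lambda>_. borel))"
proof -
  let ?S = "PiM {..<n} (\<lambda>_. borel) :: (nat \<Rightarrow> real \<times> real) measure"
  have [measurable]: "D \<in> sets (?S \<Otimes>\<^sub>M borel)" by fact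
  have [measurable]: "Measurable.pred (?S \<Otimes>\<^sub>M borel) (\<lambda>z. snd z \<in> trim (level (fst z) n))"
    by (rule measurable_compose[OF _ measurable_pred_trim, of "\<lambda>z. (level (fst z) n, snd z)", simplified]) measurable
  let ?Q = "{z \<in> space (?S \<Otimes>\<^sub>M borel). snd z \<in> trim (level (fst z) n) \<and> z \<in> D}"
  have "?Q \<in> sets (?S \<Otimes>\<^sub>M borel)" by measurable
  hence "?Q \<in> sets (?S \<Otimes>\<^sub>M lborel)" by (simp cong: sets_pair_measure_cong)
  from lborel.measurable_emeasure_Pair[OF this]
  have "(\<lambda>h. emeasure lborel (Pair h -` ?Q)) \<in> borel_measurable ?S" .
  moreover have "emeasure lborel (Pair h -` ?Q) = emeasure lborel {x \<in> trim (level h n). (h, x) \<in> D}"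
    if "h \<in> space ?S" for h
    by (rule arg_cong[where f="emeasure lborel"]) (use that in \<open>auto simp: space_pair_measure\<close>)
  ultimately show ?thesis by (simp cong: measurable_cong)
qed

text \<open>The definition of the process gives the conditional law only for products of a history
  event and a set of points. These form an intersection-stable generator, so uniqueness of finite
  measures extends the formula to all measurable sets of pairs.\<close>

lemma law:
  assumes D: "D \<in> sets (PiM {..<n} (\<lambda>_. borel) \<Otimes>\<^sub>M borel)"
  shows "emeasure M {\<omega> \<in> space M. (past n \<omega>, P \<omega> n) \<in> D} =
    (\<integral>\<^sup>+\<omega>. emeasure lborel {x \<in> trim (level (P \<omega>) n). (past n \<omega>, x) \<in> D} /
      emeasure lborel (trim (level (P \<omega>) n)) \<partial>M)"
proof -
  let ?S = "PiM {..<n} (\<lambda>_. borel) :: (nat \<Rightarrow> real \<times> real) measure"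
  define K where "K h = trim (level h n)" for h
  have K_past [simp]: "K (past n \<omega>) = K (P \<omega>)" for \<omega> by (simp add: K_def)
  have K_closed: "K h \<in> sets borel" for h using closed_trim by (simp add: K_def borel_closed)
  have K_fin: "emeasure lborel (K (P \<omega>)) < \<infinity>" for \<omega>
  proof -
    have "K (P \<omega>) \<subseteq> pentK" unfolding K_def Kn_eq_trim[symmetric] Kn_def by auto
    hence "emeasure lborel (K (P \<omega>)) \<le> emeasure lborel pentK"
      by (rule emeasure_mono) (simp add: pentK_eq_trim closed_trim)
    thus ?thesis using emeasure_pentK_finite by (rule le_less_trans)
  qed
  have [measurable]: "Measurable.pred (?S \<Otimes>\<^sub>M borel) (\<lambda>z. snd z \<in> K (fst z))"
    unfolding K_def
    by (rule measurable_compose[OF _ measurable_pred_trim, of "\<lambda>z. (level (fst z) n, snd z)", simplified]) measurable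
  have area [measurable]: "(\<lambda>h. emeasure lborel (K h)) \<in> borel_measurable ?S"
  proof -
    have "(\<lambda>h. emeasure lborel {x \<in> trim (level h n). (h, x) \<in> space (?S \<Otimes>\<^sub>M borel)}) \<in> borel_measurable ?S"
      by measurable
    moreover have "emeasure lborel {x \<in> trim (level h n). (h, x) \<in> space (?S \<Otimes>\<^sub>M borel)} = emeasure lborel (K h)"
      if "h \<in> space ?S" for h
      by (rule arg_cong[where f="emeasure lborel"]) (use that in \<open>auto simp: space_pair_measure K_def\<close>)
    ultimately show ?thesis by (simp cong: measurable_cong)
  qed
  \<comment> \<open>\<open>L\<close> is the joint law of history and next point; \<open>R\<close>
    below is the law with uniform density on the current polygon.\<close>
  define L where "L = distr M (?S \<Otimes>\<^sub>M borel) (\<lambda>\<omega>. (past n \<omega>, P \<omega> n))"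
  define f where "f = (\<lambda>z::(nat \<Rightarrow> real \<times> real) \<times> real \<times> real.
    indicator {z. snd z \<in> K (fst z)} z * inverse (emeasure lborel (K (fst z))))"
  have f[measurable]: "f \<in> borel_measurable (?S \<Otimes>\<^sub>M borel)"
    unfolding f_def by measurable
  have f'[measurable]: "f \<in> borel_measurable (distr M ?S (past n) \<Otimes>\<^sub>M lborel)"
    using f by (simp cong: measurable_cong_sets sets_pair_measure_cong)
  define R where "R = density (distr M ?S (past n) \<Otimes>\<^sub>M lborel) f"
  have sets_L: "sets L = sets (?S \<Otimes>\<^sub>M borel)" by (simp add: L_def)
  have sets_R: "sets R = sets (?S \<Otimes>\<^sub>M borel)"
    by (simp add: R_def cong: sets_pair_measure_cong)
  have eL: "emeasure L D = emeasure M {\<omega> \<in> space M. (past n \<omega>, P \<omega> n) \<in> D}"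
    if "D \<in> sets (?S \<Otimes>\<^sub>M borel)" for D
    unfolding L_def using that by (subst emeasure_distr) (auto intro!: arg_cong[where f="emeasure M"])
  have eR: "emeasure R D = (\<integral>\<^sup>+\<omega>. emeasure lborel {x \<in> K (P \<omega>). (past n \<omega>, x) \<in> D} / emeasure lborel (K (P \<omega>)) \<partial>M)"
    if D: "D \<in> sets (?S \<Otimes>\<^sub>M borel)" for D
  proof -
    have [measurable]: "D \<in> sets (?S \<Otimes>\<^sub>M borel)" by fact
    have D': "D \<in> sets (distr M ?S (past n) \<Otimes>\<^sub>M lborel)"
      using D by (simp cong: sets_pair_measure_cong)
    have g: "(\<lambda>z. f z * indicator D z) \<in> borel_measurable (distr M ?S (past n) \<Otimes>\<^sub>M lborel)"
      using D' by measurable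
    have "emeasure R D = (\<integral>\<^sup>+z. f z * indicator D z \<partial>(distr M ?S (past n) \<Otimes>\<^sub>M lborel))"
      unfolding R_def by (rule emeasure_density[OF f' D'])
    also have "\<dots> = (\<integral>\<^sup>+h. (\<integral>\<^sup>+x. f (h, x) * indicator D (h, x) \<partial>lborel) \<partial>distr M ?S (past n))"
      by (rule lborel.nn_integral_fst[symmetric, OF g])
    also have "\<dots> = (\<integral>\<^sup>+h. emeasure lborel {x \<in> K h. (h, x) \<in> D} / emeasure lborel (K h) \<partial>distr M ?S (past n))"
    proof (rule nn_integral_cong)
      fix h assume "h \<in> space (distr M ?S (past n))"
      hence h: "h \<in> space ?S" by simp
      have [measurable]: "{x \<in> K h. (h, x) \<in> D} \<in> sets borel"
      proof -
        have "Pair h -` D \<in> sets borel" by (rule sets_Pair1[OF D])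
        moreover have "{x \<in> K h. (h, x) \<in> D} = K h \<inter> Pair h -` D" by auto
        ultimately show ?thesis using K_closed by auto
      qed
      have "(\<integral>\<^sup>+x. f (h, x) * indicator D (h, x) \<partial>lborel) =
          (\<integral>\<^sup>+x. inverse (emeasure lborel (K h)) * indicator {x \<in> K h. (h, x) \<in> D} x \<partial>lborel)"
        by (rule nn_integral_cong) (auto simp: f_def indicator_def)
      also have "\<dots> = inverse (emeasure lborel (K h)) * emeasure lborel {x \<in> K h. (h, x) \<in> D}"
        by (rule nn_integral_cmult_indicator) simp
      finally show "(\<integral>\<^sup>+x. f (h, x) * indicator D (h, x) \<partial>lborel) =
          emeasure lborel {x \<in> K h. (h, x) \<in> D} / emeasure lborel (K h)"
        by (simp add: divide_ennreal_def mult.commute)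
    qed
    also have "\<dots> = (\<integral>\<^sup>+\<omega>. emeasure lborel {x \<in> K (past n \<omega>). (past n \<omega>, x) \<in> D} / emeasure lborel (K (past n \<omega>)) \<partial>M)"
    proof (rule nn_integral_distr[OF measurable_past])
      have "(\<lambda>h. emeasure lborel {x \<in> K h. (h, x) \<in> D} / emeasure lborel (K h)) \<in> borel_measurable ?S"
        unfolding K_def by (intro borel_measurable_divide_ennreal measurable_area D area[unfolded K_def])
      thus "(\<lambda>h. emeasure lborel {x \<in> K h. (h, x) \<in> D} / emeasure lborel (K h)) \<in> borel_measurable (distr M ?S (past n))"
        by simp
    qed
    finally show ?thesis by simp
  qed
  let ?B = "borel :: (real \<times> real) measure"
  let ?E = "{a \<times> b |a b. a \<in> sets ?S \<and> b \<in> sets ?B}"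
  have "L = R"
  proof (rule measure_eqI_generator_eq[where E="?E" and \<Omega>="space ?S \<times> space ?B" and A="\<lambda>_. space ?S \<times> space ?B"])
    show "Int_stable ?E" by (rule Int_stable_pair_measure_generator)
    show "?E \<subseteq> Pow (space ?S \<times> space ?B)"
      using sets.sets_into_space by fastforce
    show "sets L = sigma_sets (space ?S \<times> space ?B) ?E"
      "sets R = sigma_sets (space ?S \<times> space ?B) ?E"
      by (simp_all only: sets_L sets_R sets_pair_measure)
    show "range (\<lambda>_::nat. space ?S \<times> space ?B) \<subseteq> ?E"
      by blast
    show "(\<Union>i::nat. space ?S \<times> space ?B) = space ?S \<times> space ?B" by simp
    have "finite_measure L" unfolding L_def by (intro finite_measure_distr) measurable
    thus "emeasure L (space ?S \<times> space ?B) \<noteq> \<infinity>" for i :: nat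
      by (simp add: finite_measure.emeasure_eq_measure)
    fix X assume "X \<in> ?E"
    then obtain C B where X: "X = C \<times> B" and C[measurable]: "C \<in> sets ?S" and B[measurable]: "B \<in> sets borel" by auto
    have XS: "X \<in> sets (?S \<Otimes>\<^sub>M borel)" unfolding X by simp
    define A where "A = {\<omega> \<in> space M. past n \<omega> \<in> C}"
    have A[measurable]: "A \<in> sets M" unfolding A_def by measurable
    define r where "r \<omega> = measure lborel (B \<inter> K (P \<omega>)) / measure lborel (K (P \<omega>))" for \<omega>
    have hyp: "measure M (A \<inter> {\<omega> \<in> space M. P \<omega> n \<in> B}) = (\<integral>\<omega>\<in>A. r \<omega> \<partial>M)"
      using process C B unfolding pentagon_process_def A_def past_def r_def K_def Kn_eq_trim[symmetric]
      by (auto simp: Let_def)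
    have BK: "emeasure lborel (B \<inter> K (P \<omega>)) \<le> emeasure lborel (K (P \<omega>))" for \<omega>
      using K_closed by (intro emeasure_mono) auto
    define u v where "u \<omega> = measure lborel (B \<inter> K (P \<omega>))" and "v \<omega> = measure lborel (K (P \<omega>))" for \<omega>
    have eu: "emeasure lborel (B \<inter> K (P \<omega>)) = ennreal (u \<omega>)" for \<omega>
      unfolding u_def by (rule emeasure_eq_ennreal_measure) (use le_less_trans[OF BK K_fin] in \<open>simp add: less_top\<close>)
    have ev: "emeasure lborel (K (P \<omega>)) = ennreal (v \<omega>)" for \<omega>
      unfolding v_def by (rule emeasure_eq_ennreal_measure) (use K_fin in \<open>simp add: less_top\<close>)
    have r_uv: "r \<omega> = u \<omega> / v \<omega>" for \<omega> by (simp add: r_def u_def v_def)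
    have u0: "0 \<le> u \<omega>" and v0: "0 \<le> v \<omega>" for \<omega> by (simp_all add: u_def v_def)
    have uv: "u \<omega> \<le> v \<omega>" for \<omega> using BK[of \<omega>] v0[of \<omega>] by (simp add: eu ev)
    have r01: "0 \<le> r \<omega>" "r \<omega> \<le> 1" for \<omega>
      using u0[of \<omega>] v0[of \<omega>] uv[of \<omega>] by (auto simp: r_uv divide_le_eq_1)
    \<comment> \<open>If the polygon had area zero, both quotients would be 0 divided by 0, which is
      0 for reals and extended reals alike.\<close>
    have er: "ennreal (r \<omega>) = emeasure lborel (B \<inter> K (P \<omega>)) / emeasure lborel (K (P \<omega>))" for \<omega>
    proof (cases "v \<omega> = 0")
      case True
      thus ?thesis using u0[of \<omega>] uv[of \<omega>] by (simp add: r_uv eu ev)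
    next
      case False
      thus ?thesis using u0[of \<omega>] v0[of \<omega>] by (simp add: r_uv eu ev divide_ennreal)
    qed
    have mr: "r \<in> borel_measurable M"
    proof -
      have "(\<lambda>h. emeasure lborel {x \<in> trim (level h n). (h, x) \<in> space ?S \<times> B}) \<in> borel_measurable ?S"
        by (rule measurable_area) simp
      from measurable_compose[OF measurable_past this]
      have "(\<lambda>\<omega>. emeasure lborel {x \<in> trim (level (past n \<omega>) n). (past n \<omega>, x) \<in> space ?S \<times> B}) \<in> borel_measurable M" .
      moreover have "emeasure lborel {x \<in> trim (level (past n \<omega>) n). (past n \<omega>, x) \<in> space ?S \<times> B} =
          emeasure lborel (B \<inter> K (P \<omega>))" if "\<omega> \<in> space M" for \<omega>
        by (rule arg_cong[where f="emeasure lborel"])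
           (use measurable_space[OF measurable_past that] in \<open>auto simp: K_def\<close>)
      ultimately have 1: "(\<lambda>\<omega>. emeasure lborel (B \<inter> K (P \<omega>))) \<in> borel_measurable M"
        by (simp cong: measurable_cong)
      have 2: "(\<lambda>\<omega>. emeasure lborel (K (P \<omega>))) \<in> borel_measurable M"
        using measurable_compose[OF measurable_past area] by simp
      show ?thesis unfolding r_def measure_def using 1 2 by measurable
    qed
    have "emeasure L X = emeasure M (A \<inter> {\<omega> \<in> space M. P \<omega> n \<in> B})"
      unfolding eL[OF XS] by (rule arg_cong[where f="emeasure M"]) (auto simp: X A_def)
    also have "\<dots> = ennreal (\<integral>\<omega>\<in>A. r \<omega> \<partial>M)"
      by (simp add: emeasure_eq_measure hyp)
    also have "\<dots> = (\<integral>\<^sup>+\<omega>. ennreal (indicator A \<omega> *\<^sub>R r \<omega>) \<partial>M)"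
      unfolding set_lebesgue_integral_def
    proof (rule nn_integral_eq_integral[symmetric])
      show "integrable M (\<lambda>\<omega>. indicator A \<omega> *\<^sub>R r \<omega>)"
        by (rule integrable_const_bound[where B=1]) (use r01 mr A in \<open>auto simp: indicator_def\<close>)
      show "AE \<omega> in M. 0 \<le> indicator A \<omega> *\<^sub>R r \<omega>" using r01 by simp
    qed
    also have "\<dots> = emeasure R X" unfolding eR[OF XS]
    proof (rule nn_integral_cong)
      fix \<omega> assume w: "\<omega> \<in> space M"
      have "{x \<in> K (P \<omega>). (past n \<omega>, x) \<in> X} = (if \<omega> \<in> A then B \<inter> K (P \<omega>) else {})"
        using w by (auto simp: X A_def)
      thus "ennreal (indicator A \<omega> *\<^sub>R r \<omega>) = emeasure lborel {x \<in> K (P \<omega>). (past n \<omega>, x) \<in> X} / emeasure lborel (K (P \<omega>))"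
        using er by (auto simp: indicator_def)
    qed
    finally show "emeasure L X = emeasure R X" .
  qed
  thus ?thesis using eL[OF D] eR[OF D] by (simp add: K_def)
qed

text \<open>All later probability estimates rest on this: by uniformity, a pointwise comparison of
  areas becomes a comparison of probabilities. With \<open>C = 0\<close> it makes events of area
  zero null.\<close>

lemma prob_compare:
  assumes mA: "Measurable.pred (PiM UNIV (\<lambda>_. borel) \<Otimes>\<^sub>M borel) (\<lambda>z. A (fst z) (snd z))"
    and mB: "Measurable.pred (PiM UNIV (\<lambda>_. borel) \<Otimes>\<^sub>M borel) (\<lambda>z. B (fst z) (snd z))"
    and C: "0 \<le> C"
    and le: "AE \<omega> in M. emeasure lborel {x \<in> trim (level (P \<omega>) n). A (level (P \<omega>) n) x} \<le>
      ennreal C * emeasure lborel {x \<in> trim (level (P \<omega>) n). B (level (P \<omega>) n) x}"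
  shows "prob {\<omega> \<in> space M. A (level (P \<omega>) n) (P \<omega> n)} \<le> C * prob {\<omega> \<in> space M. B (level (P \<omega>) n) (P \<omega> n)}"
proof -
  let ?S = "PiM {..<n} (\<lambda>_. borel) :: (nat \<Rightarrow> real \<times> real) measure"
  have law': "emeasure M {\<omega> \<in> space M. A (level (P \<omega>) n) (P \<omega> n)} =
      (\<integral>\<^sup>+\<omega>. emeasure lborel {x \<in> trim (level (P \<omega>) n). A (level (P \<omega>) n) x} / emeasure lborel (trim (level (P \<omega>) n)) \<partial>M)"
    and area': "(\<lambda>\<omega>. emeasure lborel {x \<in> trim (level (P \<omega>) n). A (level (P \<omega>) n) x}) \<in> borel_measurable M"
    if m: "Measurable.pred (PiM UNIV (\<lambda>_. borel) \<Otimes>\<^sub>M borel) (\<lambda>z. A (fst z) (snd z))" for A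
  proof -
    define D where "D = {z \<in> space (?S \<Otimes>\<^sub>M borel). A (level (fst z) n) (snd z)}"
    have D: "D \<in> sets (?S \<Otimes>\<^sub>M borel)"
    proof -
      have "Measurable.pred (?S \<Otimes>\<^sub>M borel) (\<lambda>z. A (level (fst z) n) (snd z))"
        by (rule measurable_compose[OF _ m, of "\<lambda>z. (level (fst z) n, snd z)", simplified]) measurable
      thus ?thesis unfolding D_def by measurable
    qed
    have in_D: "(past n \<omega>, x) \<in> D \<longleftrightarrow> A (level (P \<omega>) n) x" if "\<omega> \<in> space M" for \<omega> x
      using measurable_space[OF measurable_past that] by (auto simp: D_def space_pair_measure)
    have "emeasure M {\<omega> \<in> space M. A (level (P \<omega>) n) (P \<omega> n)} = emeasure M {\<omega> \<in> space M. (past n \<omega>, P \<omega> n) \<in> D}"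
      by (rule arg_cong[where f="emeasure M"]) (auto simp: in_D)
    also have "\<dots> = (\<integral>\<^sup>+\<omega>. emeasure lborel {x \<in> trim (level (P \<omega>) n). A (level (P \<omega>) n) x} / emeasure lborel (trim (level (P \<omega>) n)) \<partial>M)"
      unfolding law[OF D] by (rule nn_integral_cong) (simp add: in_D)
    finally show "emeasure M {\<omega> \<in> space M. A (level (P \<omega>) n) (P \<omega> n)} =
      (\<integral>\<^sup>+\<omega>. emeasure lborel {x \<in> trim (level (P \<omega>) n). A (level (P \<omega>) n) x} / emeasure lborel (trim (level (P \<omega>) n)) \<partial>M)" .
    have "(\<lambda>\<omega>. emeasure lborel {x \<in> trim (level (past n \<omega>) n). (past n \<omega>, x) \<in> D}) \<in> borel_measurable M"
      by (rule measurable_compose[OF measurable_past measurable_area[OF D]])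
    thus "(\<lambda>\<omega>. emeasure lborel {x \<in> trim (level (P \<omega>) n). A (level (P \<omega>) n) x}) \<in> borel_measurable M"
      by (simp add: in_D cong: measurable_cong)
  qed
  have mT: "(\<lambda>\<omega>. emeasure lborel (trim (level (P \<omega>) n))) \<in> borel_measurable M"
    using area'[of "\<lambda>_ _. True"] by simp
  have "emeasure M {\<omega> \<in> space M. A (level (P \<omega>) n) (P \<omega> n)} \<le>
      (\<integral>\<^sup>+\<omega>. ennreal C * (emeasure lborel {x \<in> trim (level (P \<omega>) n). B (level (P \<omega>) n) x} / emeasure lborel (trim (level (P \<omega>) n))) \<partial>M)"
    unfolding law'[OF mA]
    by (rule nn_integral_mono_AE) (use le in eventually_elim, simp add: divide_right_mono_ennreal ennreal_times_divide)
  also have "\<dots> = ennreal C * emeasure M {\<omega> \<in> space M. B (level (P \<omega>) n) (P \<omega> n)}"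
    unfolding law'[OF mB] using area'[OF mB] mT by (intro nn_integral_cmult borel_measurable_divide_ennreal)
  finally show ?thesis using C by (simp add: emeasure_eq_measure ennreal_mult[symmetric])
qed

end

section \<open>Deterministic evolution of the gaps\<close>

lemma less_5_cases: "i < (5::nat) \<Longrightarrow> i = 0 \<or> i = 1 \<or> i = 2 \<or> i = 3 \<or> i = 4"
  by auto

text \<open>The levels are values of the support function of the convex hull of the origin and the
  chosen points; \<open>balanced\<close> is its subadditivity along
  \<open>pent_vertex_sum14\<close>.\<close>

definition balanced :: "(nat \<Rightarrow> real) \<Rightarrow> bool" where
  "balanced m \<longleftrightarrow> (\<forall>i. gr * m i \<le> m (i + 1) + m (i + 4))"

lemma step_apply: "step m x i = max (m i) (x \<bullet> pent_vertex i)"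
  by (simp add: step_def)

lemma step_ge: "m i \<le> step m x i" "x \<bullet> pent_vertex i \<le> step m x i"
  by (simp_all add: step_def)

lemma balanced_step:
  assumes "balanced m" shows "balanced (step m x)"
  unfolding balanced_def
proof
  fix i
  have "gr * m i \<le> step m x (i + 1) + step m x (i + 4)"
    using assms[unfolded balanced_def, rule_format, of i] step_ge(1)[of m "i + 1" x] step_ge(1)[of m "i + 4" x]
    by linarith
  moreover have "gr * (x \<bullet> pent_vertex i) \<le> step m x (i + 1) + step m x (i + 4)"
    using inner_pent_sum14[of x i] step_ge(2)[of x "i + 1" m] step_ge(2)[of x "i + 4" m] by linarith
  ultimately show "gr * step m x i \<le> step m x (i + 1) + step m x (i + 4)"
    unfolding step_apply[of m x i] max_def by simp
qed

text \<open>Each of the two levels on the left is either old or comes from \<open>x\<close>. Two old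
  levels are covered by admissibility, two new ones by the recurrence for products; the mixed cases
  combine the upper bound \<open>trim_inner_le\<close> for \<open>x\<close> with
  \<open>balanced\<close>.\<close>

lemma admissible_step:
  assumes m: "admissible m" and b: "balanced m" and x: "x \<in> trim m"
  shows "admissible (step m x)"
  unfolding admissible_def
proof (intro conjI allI)
  fix i
  show "step m x (i + 5) = step m x i"
    by (simp add: step_def pent_vertex_add5 admissibleD(1)[OF m])
  show "0 \<le> step m x i" using admissibleD(2)[OF m, of i] step_ge(1)[of m i x] by linarith
  let ?y = "\<lambda>k. x \<bullet> pent_vertex k"
  let ?r = "1 + gr * step m x (i + 1)"
  note per = admissibleD(1)[OF m]
  have g1: "gr * m (i + 1) \<le> gr * step m x (i + 1)" "gr * ?y (i + 1) \<le> gr * step m x (i + 1)"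
    using gr_bounds by (auto intro!: mult_left_mono step_ge)
  have 1: "m i + m (i + 2) \<le> ?r" using admissibleD(3)[OF m, of i] g1 by linarith
  have 2: "?y i + ?y (i + 2) \<le> ?r" using inner_pent_rec[of x i] g1 by linarith
  have 3: "m i + ?y (i + 2) \<le> ?r"
  proof -
    have "?y (i + 2) \<le> 1 - gr * m (i + 4) - gr * m i"
      using trim_inner_le[OF x, of "i + 2"] per[of i] by (simp add: gap_def add.assoc algebra_simps)
    moreover have "gr * (gr * m i) \<le> gr * (m (i + 1) + m (i + 4))"
      using b gr_bounds unfolding balanced_def by (intro mult_left_mono) auto
    hence "m i - gr * m i \<le> gr * m (i + 1) + gr * m (i + 4)" by (simp add: gr_mult distrib_left)
    ultimately show ?thesis using g1 by linarith
  qed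
  have 4: "?y i + m (i + 2) \<le> ?r"
  proof -
    have "?y i \<le> 1 - gr * m (i + 2) - gr * m (i + 3)"
      using trim_inner_le[OF x, of i] by (simp add: gap_def algebra_simps)
    moreover have "gr * m (i + 2) \<le> m (i + 3) + m (i + 1)"
      using b[unfolded balanced_def, rule_format, of "i + 2"] per[of "i + 1"] by (simp add: add.assoc)
    hence "gr * (gr * m (i + 2)) \<le> gr * (m (i + 3) + m (i + 1))"
      using gr_bounds by (intro mult_left_mono) auto
    hence "m (i + 2) - gr * m (i + 2) \<le> gr * m (i + 3) + gr * m (i + 1)" by (simp add: gr_mult distrib_left)
    ultimately show ?thesis using g1 by linarith
  qed
  show "step m x i + step m x (i + 2) \<le> ?r"
    using 1 2 3 4 unfolding step_apply[of m x i] step_apply[of m x "i + 2"] max_def by simp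
qed

lemma gap_step_le: "gap i (step m x) \<le> gap i m"
proof -
  have "gr * (m (i + 2) + m (i + 3)) \<le> gr * (step m x (i + 2) + step m x (i + 3))"
    using gr_bounds by (intro mult_left_mono add_mono step_ge) auto
  thus ?thesis using step_ge(1)[of m i x] by (simp add: gap_def)
qed

lemma periodic_mod5:
  assumes "admissible m"
  shows "m (i mod 5) = m i" "gap (i mod 5) m = gap i m"
  by (rule all_shift5[of m], rule admissibleD(1)[OF assms])
    (rule all_shift5[of "\<lambda>i. gap i m"], rule gap_add5[of m], rule admissibleD(1)[OF assms])

lemma step_unchanged:
  assumes m: "admissible m" and x: "\<And>i. i < 5 \<Longrightarrow> x \<bullet> pent_vertex i \<le> m i"
  shows "step m x = m"
proof
  fix i
  have "x \<bullet> pent_vertex (i mod 5) \<le> m (i mod 5)" by (rule x) simp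
  thus "step m x i = m i" using periodic_mod5(1)[OF m] by (simp add: step_def pent_vertex_mod5)
qed

text \<open>The point \<open>x\<close> just added stays in the polygon, so an edge that it moves leaves its own cap open.\<close>
lemma gap_step_hit_nonneg:
  assumes x: "x \<in> trim m" and h: "m i < x \<bullet> pent_vertex i"
  shows "0 \<le> gap i (step m x)"
proof -
  have "x \<in> trim (step m x)"
    using x rho5_pos by (auto simp: trim_def step_def diff_le_eq)
  from trim_inner_le[OF this, of i] h show ?thesis by (simp add: step_def)
qed

section \<open>Sample paths, their limits and the caps that stay open\<close>

definition valid :: "(nat \<Rightarrow> real \<times> real) \<Rightarrow> bool" where
  "valid p \<longleftrightarrow> (\<forall>n. p n \<in> trim (level p n))"

lemma valid_level:
  assumes "valid p"
  shows "admissible (level p n)" "balanced (level p n)"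
proof -
  have "admissible (level p n) \<and> balanced (level p n)"
  proof (induction n)
    case 0
    thus ?case using gr_bounds by (simp add: admissible_def balanced_def)
  next
    case (Suc n)
    thus ?case using assms by (auto simp: valid_def intro: admissible_step balanced_step)
  qed
  thus "admissible (level p n)" "balanced (level p n)" by auto
qed

lemma incseq_level: "incseq (\<lambda>n. level p n i)"
  by (rule incseq_SucI) (simp add: step_ge)

lemma decseq_gap_level: "decseq (\<lambda>n. gap i (level p n))"
  by (rule decseq_SucI) (simp add: gap_step_le)

lemma level_le_1:
  assumes "valid p" shows "level p n i \<le> 1"
proof (induction n)
  case (Suc n)
  have "p n \<bullet> pent_vertex i \<le> level p n i + gap i (level p n)"
    by (rule trim_inner_le) (use assms in \<open>simp add: valid_def\<close>)
  also have "\<dots> \<le> 1"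
  proof -
    have "0 \<le> gr * (level p n (i + 2) + level p n (i + 3))"
      using admissibleD(2)[OF valid_level(1)[OF assms]] gr_bounds by (intro mult_nonneg_nonneg add_nonneg_nonneg) auto
    thus ?thesis by (simp add: gap_def)
  qed
  finally show ?case using Suc by (simp add: step_def)
qed simp

text \<open>A step that moves an edge leaves the cap of that edge open, and a step that moves none
  changes nothing.\<close>

lemma exists_open_gap:
  assumes p: "valid p" shows "\<exists>i<5. 0 \<le> gap i (level p n)"
proof (induction n)
  case 0
  show ?case by (rule exI[of _ 0]) (simp add: gap_def)
next
  case (Suc n)
  have x: "p n \<in> trim (level p n)" using p by (simp add: valid_def)
  show ?case
  proof (cases "\<exists>i<5. level p n i < p n \<bullet> pent_vertex i")
    case True
    thus ?thesis using gap_step_hit_nonneg[OF x] by auto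
  next
    case False
    hence "p n \<bullet> pent_vertex i \<le> level p n i" if "i < 5" for i using that False by (meson not_less)
    hence "step (level p n) (p n) = level p n" by (intro step_unchanged valid_level p)
    thus ?thesis using Suc by simp
  qed
qed

text \<open>Gaps decrease, so a closed cap stays closed; if each of the five closed at some time,
  all would be closed at the latest of these times.\<close>

lemma exists_always_open_gap:
  assumes p: "valid p" shows "\<exists>i<5. \<forall>n. 0 \<le> gap i (level p n)"
proof (rule ccontr)
  assume "\<not> ?thesis"
  hence "\<forall>i\<in>{..<5}. \<exists>n. gap i (level p n) < 0" by (auto simp: not_le)
  then obtain f where f: "\<And>i. i < 5 \<Longrightarrow> gap i (level p (f i)) < 0"
    unfolding bchoice_iff by auto
  define N where "N = Max (f ` {..<5})"
  have "gap i (level p N) < 0" if "i < 5" for i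
  proof -
    have "f i \<le> N" unfolding N_def using that by auto
    hence "gap i (level p N) \<le> gap i (level p (f i))" by (rule decseqD[OF decseq_gap_level])
    thus ?thesis using f[OF that] by linarith
  qed
  thus False using exists_open_gap[OF p, of N] by (auto simp: not_le[symmetric])
qed

definition level_lim :: "(nat \<Rightarrow> real \<times> real) \<Rightarrow> nat \<Rightarrow> real" where
  "level_lim p i = (SUP n. level p n i)"

lemma level_tendsto:
  assumes "valid p" shows "(\<lambda>n. level p n i) \<longlonglongrightarrow> level_lim p i"
  unfolding level_lim_def
  by (rule LIMSEQ_incseq_SUP) (auto intro!: bdd_aboveI[of _ 1] level_le_1 assms incseq_level)

lemma gap_tendsto:
  assumes "valid p" shows "(\<lambda>n. gap i (level p n)) \<longlonglongrightarrow> gap i (level_lim p)"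
  unfolding gap_def by (intro tendsto_intros level_tendsto assms)

lemma admissible_level_lim:
  assumes p: "valid p" shows "admissible (level_lim p)"
  unfolding admissible_def
proof (intro conjI allI)
  fix i
  show "level_lim p (i + 5) = level_lim p i"
    unfolding level_lim_def using admissibleD(1)[OF valid_level(1)[OF p]] by simp
  show "0 \<le> level_lim p i"
    by (rule LIMSEQ_le_const[OF level_tendsto[OF p]]) (use admissibleD(2)[OF valid_level(1)[OF p]] in auto)
  show "level_lim p i + level_lim p (i + 2) \<le> 1 + gr * level_lim p (i + 1)"
    by (rule LIMSEQ_le[where X="\<lambda>n. level p n i + level p n (i + 2)" and Y="\<lambda>n. 1 + gr * level p n (i + 1)"])
       (use admissibleD(3)[OF valid_level(1)[OF p]] in \<open>auto intro!: tendsto_intros level_tendsto p\<close>)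
qed

lemma Kinf_eq_trim:
  assumes p: "valid p" shows "Kinf p = trim (level_lim p)"
proof (intro equalityI subsetI)
  fix x assume "x \<in> Kinf p"
  hence a: "level p n i \<le> x \<bullet> pent_vertex i + rho5" for n i
    by (auto simp: Kinf_def Kn_eq_trim trim_def diff_le_eq)
  have "level_lim p i \<le> x \<bullet> pent_vertex i + rho5" for i
    by (rule LIMSEQ_le_const2[OF level_tendsto[OF p]]) (use a in auto)
  thus "x \<in> trim (level_lim p)" by (simp add: trim_def diff_le_eq)
next
  fix x assume "x \<in> trim (level_lim p)"
  hence "level_lim p i \<le> x \<bullet> pent_vertex i + rho5" for i by (simp add: trim_def diff_le_eq)
  moreover have "level p n i \<le> level_lim p i" for n i
    by (rule incseq_le[OF incseq_level level_tendsto[OF p]])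
  ultimately show "x \<in> Kinf p"
    by (auto simp: Kinf_def Kn_eq_trim trim_def diff_le_eq intro: order_trans)
qed

text \<open>The relations give \<open>gap (i + 2) m = gap (i + 4) m\<close> and make
  \<open>gap (i + 2) m\<close> a negative multiple of \<open>gap (i + 3) m\<close>; as neither gap
  is positive, both vanish.\<close>

lemma adjacent_closed_gaps_imp_all:
  assumes m: "admissible m" and neg: "\<And>i. gap i m \<le> 0"
    and z: "gap i m = 0" "gap (i + 1) m = 0"
  shows "gap k m = 0"
proof -
  have per: "\<And>i. m (i + 5) = m i" by (rule admissibleD(1)[OF m])
  have a: "gap (i + 2) m = gap (i + 4) m"
    using gap_relation[of m i, OF per] z gr_bounds by auto
  have b: "- gap (i + 2) m = (1 + gr) * gap (i + 3) m"
    using gap_relation[of m "i + 1", OF per] z gap_add5[of m i, OF per] by (simp add: add.assoc)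
  have "(1 + gr) * gap (i + 3) m \<le> 0"
    using neg[of "i + 3"] gr_bounds by (simp add: mult_nonneg_nonpos)
  hence c: "gap (i + 2) m = 0" using b neg[of "i + 2"] by linarith
  hence d: "gap (i + 3) m = 0" using b gr_bounds by simp
  have "\<forall>k. gap k m = 0"
    by (subst all_shift5_iff[of _ i]) (use a c d z gap_add5[of m, OF per] in auto)
  thus ?thesis by blast
qed

text \<open>Apart from \<open>j\<close> itself, these are the indices whose level enters
  \<open>gap j\<close>: raising \<open>m k\<close> by some amount lowers it by \<open>gr\<close>
  times that amount.\<close>

definition coupled :: "nat \<Rightarrow> nat \<Rightarrow> bool" where
  "coupled j k \<longleftrightarrow> k = (j + 2) mod 5 \<or> k = (j + 3) mod 5"

lemma coupled_sym: "j < 5 \<Longrightarrow> coupled j k \<Longrightarrow> coupled k j"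
  unfolding coupled_def by (drule less_5_cases) (elim disjE; simp)

text \<open>The relations between the gaps leave, besides a single zero gap, only a pair \<open>i, i + 2\<close> or all five.\<close>
lemma unique_height:
  assumes p: "valid p"
    and gap_lim: "\<And>i. i < 5 \<Longrightarrow> gap i (level_lim p) \<le> 0"
    and O: "\<And>S. S = {..<5} \<or> (\<exists>i<5. S = {i, (i + 2) mod 5}) \<Longrightarrow>
      {i. i < 5 \<and> (\<forall>n. 0 \<le> gap i (level p n))} \<noteq> S"
  shows "\<exists>i<5. pent_height (Kinf p) i = rho5 \<and> (\<forall>j<5. j \<noteq> i \<longrightarrow> pent_height (Kinf p) j < rho5)"
proof -
  let ?m = "level_lim p"
  define S where "S = {i. i < 5 \<and> (\<forall>n. 0 \<le> gap i (level p n))}"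
  have m: "admissible ?m" by (rule admissible_level_lim[OF p])
  have neg: "gap i ?m \<le> 0" for i
    using gap_lim[of "i mod 5"] periodic_mod5(2)[OF m, of i] by simp
  \<comment> \<open>Gaps decrease to limits that are not positive, so staying open forever amounts
    to limit zero.\<close>
  have S_iff: "i \<in> S \<longleftrightarrow> gap i ?m = 0" if "i < 5" for i
  proof
    assume "i \<in> S"
    hence "0 \<le> gap i ?m" by (intro LIMSEQ_le_const[OF gap_tendsto[OF p]]) (auto simp: S_def)
    thus "gap i ?m = 0" using neg[of i] by linarith
  next
    assume z: "gap i ?m = 0"
    have "gap i ?m \<le> gap i (level p n)" for n
      by (rule decseq_ge[OF decseq_gap_level gap_tendsto[OF p]])
    thus "i \<in> S" using z that by (simp add: S_def)
  qed
  have adj: False if "i \<in> S" "(i + 1) mod 5 \<in> S" for i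
  proof -
    have "i < 5" using that by (simp add: S_def)
    hence "gap i ?m = 0" "gap (i + 1) ?m = 0"
      using that S_iff[of i] S_iff[of "(i + 1) mod 5"] periodic_mod5(2)[OF m, of "i + 1"] by auto
    hence "gap k ?m = 0" for k by (rule adjacent_closed_gaps_imp_all[OF m neg])
    hence "S = {..<5}" using S_iff by (auto simp: S_def)
    thus False using O unfolding S_def by blast
  qed
  have S5: "S \<subseteq> {..<5}" by (auto simp: S_def)
  \<comment> \<open>Any third index is cyclically adjacent to \<open>i\<close> or to
    \<open>i + 2\<close>, which \<open>adj\<close> excludes.\<close>
  have pair: False if ij: "i \<in> S" "(i + 2) mod 5 \<in> S" for i
  proof -
    have i: "i < 5" using ij S5 by auto
    have "S \<noteq> {i, (i + 2) mod 5}" using O i unfolding S_def by blast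
    then obtain k where k: "k \<in> S" "k \<noteq> i" "k \<noteq> (i + 2) mod 5" using ij by blast
    hence "k < 5" using S5 by auto
    hence "k = (i + 1) mod 5 \<or> k = ((i + 2) mod 5 + 1) mod 5 \<or> i = (k + 1) mod 5"
      using less_5_cases[OF \<open>k < 5\<close>] less_5_cases[OF i] k(2,3) by (elim disjE) simp_all
    thus False using adj[OF ij(1)] adj[OF ij(2)] adj[OF k(1)] ij k(1) by auto
  qed
  have uniq: "j = i" if "i \<in> S" "j \<in> S" for i j
  proof (rule ccontr)
    assume "j \<noteq> i"
    have i5: "i < 5" and j5: "j < 5" using that S5 by auto
    have "j = (i + 1) mod 5 \<or> i = (j + 1) mod 5 \<or> j = (i + 2) mod 5 \<or> i = (j + 2) mod 5"
      using less_5_cases[OF i5] less_5_cases[OF j5] \<open>j \<noteq> i\<close> by (elim disjE) simp_all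
    thus False using adj[of i] adj[of j] pair[of i] pair[of j] that by auto
  qed
  obtain i where i: "i < 5" "i \<in> S" using exists_always_open_gap[OF p] by (auto simp: S_def)
  have h: "pent_height (Kinf p) j = rho5 + gap j ?m" for j
    unfolding Kinf_eq_trim[OF p] by (rule pent_height_trim[OF m])
  have "gap j ?m < 0" if "j < 5" "j \<noteq> i" for j
    using uniq[of i j] i that S_iff[of j] neg[of j] by (auto simp: less_le)
  thus ?thesis using i S_iff[of i] h by auto
qed

lemma gap_coupled:
  assumes "j < 5" "coupled j k"
  obtains l where "l < 5" "l \<noteq> j" "l \<noteq> k" "\<And>m. admissible m \<Longrightarrow> gap j m = 1 - m j - gr * (m k + m l)"
proof -
  have d: "(j + 2) mod 5 \<noteq> j" "(j + 3) mod 5 \<noteq> j" "(j + 2) mod 5 \<noteq> (j + 3) mod 5"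
    using assms(1) by presburger+
  have g: "gap j m = 1 - m j - gr * (m ((j + 2) mod 5) + m ((j + 3) mod 5))" if "admissible m" for m
    by (simp add: gap_def periodic_mod5(1)[OF that])
  show ?thesis
  proof (cases "k = (j + 2) mod 5")
    case True
    show ?thesis by (rule that[of "(j + 3) mod 5"]) (use True d g in auto)
  next
    case False
    hence "k = (j + 3) mod 5" using assms by (simp add: coupled_def)
    thus ?thesis using d g by (intro that[of "(j + 2) mod 5"]) (auto simp: add.commute)
  qed
qed

lemma coupled_neq: "j < 5 \<Longrightarrow> coupled j k \<Longrightarrow> k \<noteq> j \<and> k < 5"
  unfolding coupled_def by (drule less_5_cases) (elim disjE; simp)

section \<open>Killing and sowing for a set \<open>S\<close> of open caps\<close>

context
  fixes S :: "nat set"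
begin

definition alive :: "(nat \<Rightarrow> real) \<Rightarrow> bool" where
  "alive m \<longleftrightarrow> (\<forall>i\<in>S. 0 < gap i m)"

text \<open>\<open>S\<close> is a candidate for the set of caps that stay open; if it is the right
  one, a path almost surely ends up in this regime. The bound \<open>1/50\<close> is the thickness
  up to which caps are disjoint and equal to corners.\<close>

definition late :: "(nat \<Rightarrow> real) \<Rightarrow> bool" where
  "late m \<longleftrightarrow> alive m \<and> (\<forall>i\<in>S. gap i m \<le> 1/50) \<and> (\<forall>i\<in>{..<5} - S. gap i m < 0)"

text \<open>The second condition lets one hit at \<open>k\<close> close cap \<open>j\<close>. The
  third keeps \<open>gap k\<close> comparable to the largest gap, so that such a hit takes a fixed
  share of the total area of the open caps.\<close>

definition ripe_pair :: "(nat \<Rightarrow> real) \<Rightarrow> nat \<Rightarrow> nat \<Rightarrow> bool" where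
  "ripe_pair m j k \<longleftrightarrow> coupled j k \<and> gap j m \<le> 11/20 * gap k m \<and> (\<forall>l\<in>S. 38/100 * gap l m \<le> gap k m)"

text \<open>In a ripe state one hit near the top of the \<open>k\<close>th cap closes the \<open>j\<close>th cap (\<open>kill\<close>); in a state that is
  not ripe, a hit near the top of a cap coupled to the largest one makes it ripe (\<open>sow\<close>). The tolerances \<open>11/20\<close>,
  \<open>38/100\<close>, \<open>9/10\<close> work because \<open>11/20 < 9/10 * gr\<close> and \<open>38/100 < 1 - gr\<close>.\<close>
definition ripe :: "(nat \<Rightarrow> real) \<Rightarrow> bool" where
  "ripe m \<longleftrightarrow> (\<exists>j\<in>S. \<exists>k\<in>S. ripe_pair m j k)"

definition hit :: "(nat \<Rightarrow> real) \<Rightarrow> real \<times> real \<Rightarrow> bool" where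
  "hit m x \<longleftrightarrow> (\<exists>i\<in>{..<5}. m i < x \<bullet> pent_vertex i)"

definition kill :: "(nat \<Rightarrow> real) \<Rightarrow> real \<times> real \<Rightarrow> bool" where
  "kill m x \<longleftrightarrow> (\<exists>j\<in>S. \<exists>k\<in>S. ripe_pair m j k \<and> m k + 9/10 * gap k m \<le> x \<bullet> pent_vertex k)"

definition sow :: "(nat \<Rightarrow> real) \<Rightarrow> real \<times> real \<Rightarrow> bool" where
  "sow m x \<longleftrightarrow> (\<exists>j\<in>S. \<exists>k\<in>S. coupled j k \<and> (\<forall>l\<in>S. gap l m \<le> gap k m) \<and> 11/20 * gap k m \<le> gap j m \<and>
     m j + 9/10 * gap j m \<le> x \<bullet> pent_vertex j)"

lemma alive_step: "alive (step m x) \<Longrightarrow> alive m"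
  unfolding alive_def using gap_step_le less_le_trans by blast

lemma late_step: "late m \<Longrightarrow> alive (step m x) \<Longrightarrow> late (step m x)"
  unfolding late_def by (intro conjI ballI; (rule order_trans[OF gap_step_le] le_less_trans[OF gap_step_le])?) auto

text \<open>The hit lowers \<open>gap j\<close> by at least \<open>gr * 9/10 * gap k\<close>, more
  than the \<open>11/20 * gap k\<close> that bounds it.\<close>

lemma kill_closes:
  assumes S: "S \<subseteq> {..<5}" and m: "admissible m" and m': "admissible (step m x)"
    and a: "alive m" and k: "kill m x"
  shows "\<not> alive (step m x)"
proof -
  from k obtain j k where jk: "j \<in> S" "k \<in> S" "ripe_pair m j k" "m k + 9/10 * gap k m \<le> x \<bullet> pent_vertex k"
    by (auto simp: kill_def)
  have "j < 5" "coupled j k" using jk S by (auto simp: ripe_pair_def)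
  then obtain l where "l < 5" "l \<noteq> j" "l \<noteq> k"
    and l: "\<And>m. admissible m \<Longrightarrow> gap j m = 1 - m j - gr * (m k + m l)"
    by (rule gap_coupled) (rule that)
  have "gr * ((m k + 9/10 * gap k m) + m l) \<le> gr * (step m x k + step m x l)"
    using jk gr_bounds step_ge(1)[of m l x] step_ge(2)[of x k m] by (intro mult_left_mono add_mono) auto
  hence "gap j (step m x) \<le> gap j m - gr * (9/10 * gap k m)"
    unfolding l[OF m] l[OF m'] using step_ge(1)[of m j x] by (simp add: algebra_simps)
  moreover have "618/1000 * (9/10 * gap k m) \<le> gr * (9/10 * gap k m)"
    using gr_bounds a jk by (intro mult_right_mono) (auto simp: alive_def intro: less_imp_le)
  moreover have "0 < gap k m" using a jk by (auto simp: alive_def)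
  moreover have "gap j m \<le> 11/20 * gap k m" using jk by (simp add: ripe_pair_def)
  ultimately have "gap j (step m x) < 0" by linarith
  thus ?thesis using jk by (auto simp: alive_def not_less intro!: bexI[of _ j])
qed

text \<open>In a late state a point that moves edge \<open>i\<close> lies in the cap at
  \<open>i\<close> of thickness \<open>1/50\<close>, and this cap is disjoint from the one at
  \<open>j\<close>.\<close>

lemma single_hit:
  assumes m: "admissible m" and l: "late m" and x: "x \<in> trim m"
    and j: "j < 5" "m j + gap j m - 1/50 \<le> x \<bullet> pent_vertex j" and i: "i < 5" "i \<noteq> j"
  shows "step m x i = m i"
proof -
  have "x \<bullet> pent_vertex i \<le> m i"
  proof (rule ccontr)
    assume h: "\<not> x \<bullet> pent_vertex i \<le> m i"
    hence "0 < gap i m" using trim_inner_le[OF x, of i] by linarith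
    moreover have "i \<in> S \<or> gap i m < 0" using l i(1) unfolding late_def by blast
    ultimately have "gap i m \<le> 1/50" using l unfolding late_def by (auto dest: less_asym)
    hence "x \<in> cap i (1/50) m" "x \<in> cap j (1/50) m" using h x j by (auto simp: cap_def)
    hence "i mod 5 = j mod 5" by (intro cap_disjoint_all[OF m])
    thus False using i j by simp
  qed
  thus ?thesis by (simp add: step_def)
qed

text \<open>Only level \<open>j\<close> moves. Its own gap shrinks to at most a tenth, while
  \<open>gap k\<close> loses at most \<open>gr * gap j m\<close>, hence at most
  \<open>gr * gap k m\<close>, and keeps \<open>38/100\<close> of its size. The other gaps can only
  decrease, so \<open>j\<close> and \<open>k\<close> form a ripe pair.\<close>

lemma sow_ripens:
  assumes S: "S \<subseteq> {..<5}" and m: "admissible m" and m': "admissible (step m x)"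
    and x: "x \<in> trim m" and l: "late m" and s: "sow m x"
  shows "ripe (step m x)"
proof -
  from s obtain j k where jk: "j \<in> S" "k \<in> S" "coupled j k" "\<And>l. l \<in> S \<Longrightarrow> gap l m \<le> gap k m"
    "m j + 9/10 * gap j m \<le> x \<bullet> pent_vertex j"
    by (auto simp: sow_def)
  let ?m = "step m x"
  have lt: "j < 5" "k < 5" "k \<noteq> j" using jk S coupled_neq[of j k] by auto
  have gj: "0 < gap j m" "gap j m \<le> 1/50" and gk: "0 < gap k m" using l jk by (auto simp: late_def alive_def)
  have keep: "?m i = m i" if "i < 5" "i \<noteq> j" for i
    by (rule single_hit[OF m l x lt(1) _ that]) (use jk gj in linarith)
  have mj: "m j + 9/10 * gap j m \<le> ?m j" "?m j \<le> m j + gap j m"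
    using jk gj trim_inner_le[OF x, of j] by (auto simp: step_def)
  obtain a where a: "a < 5" "a \<noteq> j" "a \<noteq> k" "\<And>m. admissible m \<Longrightarrow> gap j m = 1 - m j - gr * (m k + m a)"
    by (rule gap_coupled[OF lt(1) jk(3)]) (rule that)
  obtain b where b: "b < 5" "b \<noteq> k" "b \<noteq> j" "\<And>m. admissible m \<Longrightarrow> gap k m = 1 - m k - gr * (m j + m b)"
    by (rule gap_coupled[OF lt(2) coupled_sym[OF lt(1) jk(3)]]) (rule that)
  have "gap j ?m = gap j m - (?m j - m j)"
    using keep[OF a(1,2)] keep[OF lt(2,3)] by (simp add: a(4)[OF m] a(4)[OF m'])
  hence g1: "gap j ?m \<le> 1/10 * gap j m" using mj by linarith
  have "gap k ?m = gap k m - gr * (?m j - m j)"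
    using keep[OF b(1,3)] keep[OF lt(2,3)] by (simp add: b(4)[OF m] b(4)[OF m'] algebra_simps)
  moreover have "gr * (?m j - m j) \<le> gr * gap k m"
    using mj gr_bounds jk(4)[OF jk(1)] by (intro mult_left_mono) auto
  moreover have "gr * gap k m \<le> 62/100 * gap k m" using gr_bounds gk by (intro mult_right_mono) auto
  ultimately have g2: "38/100 * gap k m \<le> gap k ?m" by linarith
  have "38/100 * gap l ?m \<le> gap k ?m" if "l \<in> S" for l
    using gap_step_le[of l m x] jk(4)[OF that] g2 by simp
  moreover have "gap j ?m \<le> 11/20 * gap k ?m" using g1 g2 jk(4)[OF jk(1)] gk by simp
  ultimately show ?thesis using jk by (auto simp: ripe_def ripe_pair_def)
qed

lemma hit_area_le:
  assumes S: "S \<subseteq> {..<5}" and m: "admissible m" and l: "late m" and b: "0 < b"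
    and area: "\<And>i t. 0 \<le> t \<Longrightarrow> emeasure lborel (cap i t m) \<le> ennreal (b * t^2)"
    and g: "\<And>i. i \<in> S \<Longrightarrow> gap i m \<le> G"
  shows "emeasure lborel {x \<in> trim m. hit m x} \<le> ennreal (5 * b * G^2)"
proof -
  have fS: "finite S" "card S \<le> 5" using S finite_subset card_mono[OF finite_lessThan S] by auto
  have "closed (cap i t m)" for i t
  proof -
    have "cap i t m = trim m \<inter> {x. m i + gap i m - t \<le> x \<bullet> pent_vertex i}" by (auto simp: cap_def)
    thus ?thesis by (auto intro!: closed_Int closed_trim closed_Collect_le continuous_intros)
  qed
  hence ms: "cap i t m \<in> sets lborel" for i t by simp
  have "{x \<in> trim m. hit m x} \<subseteq> (\<Union>i\<in>S. cap i (gap i m) m)"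
  proof
    fix x assume "x \<in> {x \<in> trim m. hit m x}"
    then obtain i where i: "x \<in> trim m" "i < 5" "m i < x \<bullet> pent_vertex i" by (auto simp: hit_def)
    hence "0 < gap i m" using trim_inner_le[of x m i] by linarith
    moreover have "i \<in> S \<or> gap i m < 0" using l i(2) unfolding late_def by blast
    ultimately have "i \<in> S" by linarith
    thus "x \<in> (\<Union>i\<in>S. cap i (gap i m) m)" using i by (auto simp: cap_def intro!: bexI[of _ i])
  qed
  hence "emeasure lborel {x \<in> trim m. hit m x} \<le> emeasure lborel (\<Union>i\<in>S. cap i (gap i m) m)"
    using ms fS by (intro emeasure_mono) auto
  also have "\<dots> \<le> (\<Sum>i\<in>S. emeasure lborel (cap i (gap i m) m))"
    by (rule emeasure_subadditive_finite) (use fS ms in auto)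
  also have "\<dots> \<le> (\<Sum>i\<in>S. ennreal (b * G^2))"
  proof (rule sum_mono)
    fix i assume i: "i \<in> S"
    hence p: "0 < gap i m" using l by (auto simp: late_def alive_def)
    have "emeasure lborel (cap i (gap i m) m) \<le> ennreal (b * (gap i m)^2)" using p by (intro area) auto
    also have "\<dots> \<le> ennreal (b * G^2)" using b g[OF i] p by (intro ennreal_leI mult_left_mono power_mono) auto
    finally show "emeasure lborel (cap i (gap i m) m) \<le> ennreal (b * G^2)" .
  qed
  also have "\<dots> = ennreal (real (card S) * (b * G^2))" using b
    by (simp add: ennreal_mult ennreal_of_nat_eq_real_of_nat)
  also have "\<dots> \<le> ennreal (5 * (b * G^2))" using b fS(2) by (intro ennreal_leI mult_right_mono) auto
  finally show ?thesis by (simp add: mult.assoc)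
qed

end

section \<open>Gaps converge to zero or become negative\<close>

lemma measurable_level_component [measurable]:
  "(\<lambda>z. fst z i) \<in> borel_measurable (PiM UNIV (\<lambda>_::nat. borel :: real measure) \<Otimes>\<^sub>M (borel :: (real \<times> real) measure))"
  by (rule measurable_compose[OF measurable_fst measurable_component_singleton]) simp

lemma measurable_gap [measurable]:
  "(\<lambda>z. gap i (fst z)) \<in> borel_measurable (PiM UNIV (\<lambda>_::nat. borel :: real measure) \<Otimes>\<^sub>M (borel :: (real \<times> real) measure))"
  unfolding gap_def by measurable

lemma measurable_gap_step [measurable]:
  "(\<lambda>z. gap i (step (fst z) (snd z))) \<in> borel_measurable (PiM UNIV (\<lambda>_::nat. borel :: real measure) \<Otimes>\<^sub>M (borel :: (real \<times> real) measure))"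
  unfolding gap_def step_def by measurable

lemma measurable_late [measurable]:
  "Measurable.pred (PiM UNIV (\<lambda>_::nat. borel :: real measure) \<Otimes>\<^sub>M (borel :: (real \<times> real) measure)) (\<lambda>z. late S (fst z))"
  unfolding late_def alive_def by measurable

lemma measurable_ripe_pair [measurable]:
  "Measurable.pred (PiM UNIV (\<lambda>_::nat. borel :: real measure) \<Otimes>\<^sub>M (borel :: (real \<times> real) measure)) (\<lambda>z. ripe_pair S (fst z) j k)"
  unfolding ripe_pair_def by measurable

lemma measurable_ripe [measurable]:
  "Measurable.pred (PiM UNIV (\<lambda>_::nat. borel :: real measure) \<Otimes>\<^sub>M (borel :: (real \<times> real) measure)) (\<lambda>z. ripe S (fst z))"
  unfolding ripe_def by measurable

lemma measurable_hit [measurable]: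
  "Measurable.pred (PiM UNIV (\<lambda>_::nat. borel :: real measure) \<Otimes>\<^sub>M (borel :: (real \<times> real) measure)) (\<lambda>z. hit (fst z) (snd z))"
  unfolding hit_def by measurable

lemma measurable_kill [measurable]:
  "Measurable.pred (PiM UNIV (\<lambda>_::nat. borel :: real measure) \<Otimes>\<^sub>M (borel :: (real \<times> real) measure)) (\<lambda>z. kill S (fst z) (snd z))"
  unfolding kill_def by measurable

lemma measurable_sow [measurable]:
  "Measurable.pred (PiM UNIV (\<lambda>_::nat. borel :: real measure) \<Otimes>\<^sub>M (borel :: (real \<times> real) measure)) (\<lambda>z. sow S (fst z) (snd z))"
  unfolding sow_def by measurable

text \<open>The new gap is piecewise linear in \<open>x\<close>, with eight branches according to
  which of its three levels are renewed. With none renewed it is the old nonzero gap, with all three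
  renewed it is 1 because the products cancel; each of the other six branches vanishes only on a
  line, and \<open>?C\<close> lists these lines.\<close>

lemma negligible_gap_step_zero:
  assumes g: "gap i m \<noteq> 0"
  shows "negligible {x. gap i (step m x) = 0}"
proof -
  define H where "H k c = {x::real \<times> real. pent_vertex k \<bullet> x = c}" for k c
  have nH: "negligible (H k c)" for k c
  proof -
    have "pent_vertex k \<noteq> 0" using inner_pent_pent(1)[of k] by auto
    thus ?thesis unfolding H_def by (intro negligible_hyperplane) auto
  qed
  let ?C = "{(i, 1 - gr * (m (i + 2) + m (i + 3))), (i, m i - 1),
    (i + 2, (1 - m i - gr * m (i + 3)) / gr), (i + 2, (gr * m (i + 2) - 1) / gr),
    (i + 3, (1 - m i - gr * m (i + 2)) / gr), (i + 3, (gr * m (i + 3) - 1) / gr)}"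
  have "{x. gap i (step m x) = 0} \<subseteq> (\<Union>(k, c)\<in>?C. H k c)"
  proof
    fix x assume "x \<in> {x. gap i (step m x) = 0}"
    hence z: "step m x i + gr * step m x (i + 2) + gr * step m x (i + 3) = 1"
      by (simp add: gap_def algebra_simps)
    define a b c where "a = x \<bullet> pent_vertex i" and "b = x \<bullet> pent_vertex (i + 2)" and "c = x \<bullet> pent_vertex (i + 3)"
    have s: "a + gr * b + gr * c = 0" using inner_pent_sum23[of x i] by (simp add: a_def b_def c_def algebra_simps)
    have g0: "gr \<noteq> 0" using gr_bounds by simp
    have st: "step m x i = m i \<or> step m x i = a" "step m x (i + 2) = m (i + 2) \<or> step m x (i + 2) = b"
      "step m x (i + 3) = m (i + 3) \<or> step m x (i + 3) = c"
      by (auto simp: step_def a_def b_def c_def max_def)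
    have "a = 1 - gr * (m (i + 2) + m (i + 3)) \<or> a = m i - 1 \<or>
      gr * b = 1 - m i - gr * m (i + 3) \<or> gr * b = gr * m (i + 2) - 1 \<or>
      gr * c = 1 - m i - gr * m (i + 2) \<or> gr * c = gr * m (i + 3) - 1"
      using st(1)
    proof
      assume 1: "step m x i = m i"
      show ?thesis using st(2)
      proof
        assume 2: "step m x (i + 2) = m (i + 2)"
        show ?thesis using st(3) z g s unfolding 1 2 gap_def by (auto simp: algebra_simps)
      next
        assume 2: "step m x (i + 2) = b"
        show ?thesis using st(3)
        proof
          assume 3: "step m x (i + 3) = m (i + 3)"
          have "gr * b = 1 - m i - gr * m (i + 3)" using z unfolding 1 2 3 by linarith
          thus ?thesis by blast
        next
          assume 3: "step m x (i + 3) = c"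
          have "a = m i - 1" using z s unfolding 1 2 3 by linarith
          thus ?thesis by blast
        qed
      qed
    next
      assume 1: "step m x i = a"
      show ?thesis using st(2)
      proof
        assume 2: "step m x (i + 2) = m (i + 2)"
        show ?thesis using st(3)
        proof
          assume 3: "step m x (i + 3) = m (i + 3)"
          have "a = 1 - gr * (m (i + 2) + m (i + 3))" using z unfolding 1 2 3 by (simp add: algebra_simps)
          thus ?thesis by blast
        next
          assume 3: "step m x (i + 3) = c"
          have "gr * b = gr * m (i + 2) - 1" using z s unfolding 1 2 3 by linarith
          thus ?thesis by blast
        qed
      next
        assume 2: "step m x (i + 2) = b"
        show ?thesis using st(3)
        proof
          assume 3: "step m x (i + 3) = m (i + 3)"
          have "gr * c = gr * m (i + 3) - 1" using z s unfolding 1 2 3 by linarith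
          thus ?thesis by blast
        next
          assume 3: "step m x (i + 3) = c"
          have False using z s unfolding 1 2 3 by linarith
          thus ?thesis ..
        qed
      qed
    qed
    thus "x \<in> (\<Union>(k, c)\<in>?C. H k c)"
      using g0 unfolding H_def a_def b_def c_def
      by (simp add: inner_commute nonzero_eq_divide_eq mult.commute)
  qed
  moreover have "negligible (\<Union>(k, c)\<in>?C. H k c)"
    using nH by (intro negligible_Union) auto
  ultimately show ?thesis by (rule negligible_subset[rotated])
qed

context pent_process
begin

lemma sets_event [measurable]:
  assumes "Measurable.pred (PiM UNIV (\<lambda>_. borel) \<Otimes>\<^sub>M borel) (\<lambda>z. A (fst z) (snd z))"
  shows "{\<omega> \<in> space M. A (level (P \<omega>) n) (P \<omega> n)} \<in> sets M"
proof -
  have "Measurable.pred M (\<lambda>\<omega>. A (level (P \<omega>) n) (P \<omega> n))"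
    by (rule measurable_compose[OF _ assms, of "\<lambda>\<omega>. (level (P \<omega>) n, P \<omega> n)", simplified]) measurable
  thus ?thesis by measurable
qed

lemma AE_step_avoids_null:
  assumes mA: "Measurable.pred (PiM UNIV (\<lambda>_. borel) \<Otimes>\<^sub>M borel) (\<lambda>z. A (fst z) (snd z))"
    and z: "\<And>m. emeasure lborel {x \<in> trim m. A m x} = 0"
  shows "AE \<omega> in M. \<forall>n. \<not> A (level (P \<omega>) n) (P \<omega> n)"
  unfolding AE_all_countable
proof
  fix n
  have "prob {\<omega> \<in> space M. A (level (P \<omega>) n) (P \<omega> n)} \<le> 0 * prob {\<omega> \<in> space M. True}"
    by (rule prob_compare[OF mA]) (use z in auto)
  hence "prob {\<omega> \<in> space M. A (level (P \<omega>) n) (P \<omega> n)} = 0" using measure_nonneg by (simp add: measure_le_0_iff)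
  thus "AE \<omega> in M. \<not> A (level (P \<omega>) n) (P \<omega> n)"
    using sets_event[OF mA, of n] by (simp add: AE_iff_measurable[OF _ refl] emeasure_eq_measure)
qed

lemma AE_valid: "AE \<omega> in M. valid (P \<omega>)"
proof -
  have "AE \<omega> in M. \<forall>n. \<not> P \<omega> n \<notin> trim (level (P \<omega>) n)"
  proof (rule AE_step_avoids_null)
    show "Measurable.pred (PiM UNIV (\<lambda>_. borel) \<Otimes>\<^sub>M borel) (\<lambda>z. snd z \<notin> trim (fst z))" by measurable
    have "{x \<in> trim m. x \<notin> trim m} = {}" for m by auto
    thus "emeasure lborel {x \<in> trim m. x \<notin> trim m} = 0" for m by simp
  qed
  thus ?thesis by (simp add: valid_def)
qed

text \<open>Each gap starts at 1, and a step from a nonzero gap to zero is a null event.\<close>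

lemma AE_gap_nonzero: "AE \<omega> in M. \<forall>n i. gap i (level (P \<omega>) n) \<noteq> 0"
proof -
  have avoid: "AE \<omega> in M. \<forall>n. \<not> (gap i (level (P \<omega>) n) \<noteq> 0 \<and> gap i (step (level (P \<omega>) n) (P \<omega> n)) = 0)" for i
  proof (rule AE_step_avoids_null)
    show "Measurable.pred (PiM UNIV (\<lambda>_. borel) \<Otimes>\<^sub>M borel)
        (\<lambda>z. gap i (fst z) \<noteq> 0 \<and> gap i (step (fst z) (snd z)) = 0)" by measurable
    fix m
    show "emeasure lborel {x \<in> trim m. gap i m \<noteq> 0 \<and> gap i (step m x) = 0} = 0"
    proof (cases "gap i m = 0")
      case False
      have "continuous_on UNIV (\<lambda>x. gap i (step m x))"
        unfolding gap_def step_def by (intro continuous_intros)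
      hence c: "closed {x. gap i (step m x) = 0}" by (intro closed_Collect_eq) auto
      have "{x. gap i (step m x) = 0} \<in> null_sets lebesgue"
        using negligible_gap_step_zero[OF False] by (simp add: negligible_iff_null_sets)
      moreover have "{x. gap i (step m x) = 0} \<in> sets lborel" using c by simp
      ultimately have "{x. gap i (step m x) = 0} \<in> null_sets lborel"
        by (simp only: null_sets_completion_iff)
      moreover have "trim m \<in> sets lborel" using closed_trim[of m] by simp
      ultimately have "trim m \<inter> {x. gap i (step m x) = 0} \<in> null_sets lborel"
        by (rule null_set_Int1)
      moreover have "{x \<in> trim m. gap i m \<noteq> 0 \<and> gap i (step m x) = 0} = trim m \<inter> {x. gap i (step m x) = 0}"
        using False by blast
      ultimately show ?thesis by (simp add: null_sets_def)
    qed simp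
  qed
  have "AE \<omega> in M. \<forall>i. \<forall>n. \<not> (gap i (level (P \<omega>) n) \<noteq> 0 \<and> gap i (step (level (P \<omega>) n) (P \<omega> n)) = 0)"
    by (subst AE_all_countable) (intro allI avoid)
  thus ?thesis
  proof eventually_elim
    case (elim \<omega>)
    show ?case
    proof (intro allI)
      fix n i show "gap i (level (P \<omega>) n) \<noteq> 0"
        by (induction n) (use elim in \<open>auto simp: gap_def\<close>)
    qed
  qed
qed

lemma sum_prob_le:
  assumes E: "\<And>n. E n \<in> sets M" and le: "AE \<omega> in M. (\<Sum>n<N. indicator (E n) \<omega> :: real) \<le> c"
  shows "(\<Sum>n<N. prob (E n)) \<le> c"
proof -
  have "(\<Sum>n<N. prob (E n)) = (\<integral>\<omega>. (\<Sum>n<N. indicator (E n) \<omega>) \<partial>M)"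
    using E by (subst Bochner_Integration.integral_sum) (auto simp: emeasure_eq_measure)
  also have "\<dots> \<le> (\<integral>\<omega>. c \<partial>M)"
    by (rule integral_mono_AE) (use E le in \<open>auto simp: emeasure_eq_measure\<close>)
  finally show ?thesis by (simp add: prob_space)
qed

lemma AE_eventually_not:
  assumes E: "\<And>n. E n \<in> sets M" and le: "\<And>N. (\<Sum>n<N. prob (E n)) \<le> c"
  shows "AE \<omega> in M. eventually (\<lambda>n. \<omega> \<notin> E n) sequentially"
proof -
  have "summable (\<lambda>n. prob (E n))"
    by (rule summableI_nonneg_bounded[of _ c]) (use le in auto)
  hence "AE \<omega> in M. eventually (\<lambda>n. \<omega> \<in> space M - E n) sequentially"
    by (intro borel_cantelli_AE1 E) (auto simp: emeasure_eq_measure)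
  thus ?thesis by (rule AE_mp) (auto elim: eventually_mono)
qed

text \<open>While the gap is at least \<open>e\<close>, the next point falls into the cap of
  thickness \<open>e/2\<close> with probability bounded below. Such a point raises
  \<open>m i\<close> by at least \<open>e/2\<close>, which is possible at most \<open>2 / e\<close>
  times as levels stay below 1. So the probabilities of a gap of at least \<open>e\<close> have a
  finite sum, and Borel--Cantelli applies.\<close>

lemma AE_gap_small:
  assumes e: "0 < e" "e \<le> 1/50"
  shows "AE \<omega> in M. eventually (\<lambda>n. gap i (level (P \<omega>) n) < e) sequentially"
proof -
  obtain a b where ab: "0 < a" "0 < b"
    and "\<And>i m t. admissible m \<Longrightarrow> 0 \<le> t \<Longrightarrow> emeasure lborel (cap i t m) \<le> ennreal (b * t^2)"
    and lower: "\<And>i m t. admissible m \<Longrightarrow> 0 \<le> t \<Longrightarrow> t \<le> 1/50 \<Longrightarrow> ennreal (a * t^2) \<le> emeasure lborel (cap i t m)"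
    by (rule cap_area_bounds) (rule that)
  define k where "k = measure lborel pentK"
  have k: "emeasure lborel pentK = ennreal k" unfolding k_def
    by (rule emeasure_eq_ennreal_measure) (use emeasure_pentK_finite in auto)
  define B where "B m x \<longleftrightarrow> e \<le> gap i m \<and> m i + e/2 \<le> x \<bullet> pent_vertex i" for m and x :: "real \<times> real"
  define C where "C = k / (a * (e/2)^2)"
  have C: "0 \<le> C" using ab by (simp add: C_def k_def)
  have mA: "Measurable.pred (PiM UNIV (\<lambda>_. borel) \<Otimes>\<^sub>M (borel :: (real \<times> real) measure)) (\<lambda>z. e \<le> gap i (fst z))"
    by measurable
  have mB: "Measurable.pred (PiM UNIV (\<lambda>_. borel) \<Otimes>\<^sub>M (borel :: (real \<times> real) measure)) (\<lambda>z. B (fst z) (snd z))"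
    unfolding B_def by measurable
  define EB where "EB n = {\<omega> \<in> space M. B (level (P \<omega>) n) (P \<omega> n)}" for n
  define EA where "EA n = {\<omega> \<in> space M. e \<le> gap i (level (P \<omega>) n)}" for n
  have EA: "EA n \<in> sets M" and EB: "EB n \<in> sets M" for n
    unfolding EA_def EB_def by (rule sets_event[OF mA], rule sets_event[OF mB])
  have cmp: "prob (EA n) \<le> C * prob (EB n)" for n
    unfolding EA_def EB_def
  proof (rule prob_compare[where A="\<lambda>m x. e \<le> gap i m" and B=B, OF mA mB C])
    show "AE \<omega> in M. emeasure lborel {x \<in> trim (level (P \<omega>) n). e \<le> gap i (level (P \<omega>) n)}
         \<le> ennreal C * emeasure lborel {x \<in> trim (level (P \<omega>) n). B (level (P \<omega>) n) x}"
      using AE_valid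
    proof eventually_elim
      case (elim \<omega>)
      define m where "m = level (P \<omega>) n"
      have m: "admissible m" unfolding m_def by (rule valid_level[OF elim])
      show ?case unfolding m_def[symmetric]
      proof (cases "e \<le> gap i m")
        case True
        have cl: "closed {x \<in> trim m. B m x}"
        proof -
          have "{x \<in> trim m. B m x} = trim m \<inter> {x. m i + e/2 \<le> x \<bullet> pent_vertex i}" using True by (auto simp: B_def)
          thus ?thesis by (auto intro!: closed_Int closed_trim closed_Collect_le continuous_intros)
        qed
        have "trim m \<subseteq> pentK"
        proof
          fix x assume x: "x \<in> trim m"
          have "0 - rho5 \<le> x \<bullet> pent_vertex i" for i
            using x admissibleD(2)[OF m, of i] by (auto simp: trim_def dest!: spec[of _ i])
          thus "x \<in> pentK" by (simp add: pentK_halfplanes)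
        qed
        hence "emeasure lborel {x \<in> trim m. e \<le> gap i m} \<le> ennreal k"
          unfolding k[symmetric] by (intro emeasure_mono) (auto simp: pentK_eq_trim closed_trim)
        also have "\<dots> = ennreal C * ennreal (a * (e/2)^2)"
          using ab e C by (simp add: C_def ennreal_mult[symmetric] k_def)
        also have "\<dots> \<le> ennreal C * emeasure lborel (cap i (e/2) m)"
          using e by (intro mult_left_mono lower m) auto
        also have "\<dots> \<le> ennreal C * emeasure lborel {x \<in> trim m. B m x}"
          using True cl by (intro mult_left_mono emeasure_mono) (auto simp: B_def cap_def)
        finally show "emeasure lborel {x \<in> trim m. e \<le> gap i m} \<le> ennreal C * emeasure lborel {x \<in> trim m. B m x}" .
      qed simp
    qed
  qed
  have "(\<Sum>n<N. prob (EB n)) \<le> 2 / e" for N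
  proof (rule sum_prob_le[OF EB])
    show "AE \<omega> in M. (\<Sum>n<N. indicator (EB n) \<omega> :: real) \<le> 2 / e"
      using AE_valid
    proof eventually_elim
      case (elim \<omega>)
      have "(e/2) * (\<Sum>n<N. indicator (EB n) \<omega>) \<le> level (P \<omega>) N i"
      proof (induction N)
        case (Suc N)
        have "(e/2) * indicator (EB N) \<omega> \<le> level (P \<omega>) (Suc N) i - level (P \<omega>) N i"
          by (auto simp: indicator_def EB_def B_def step_def)
        thus ?case using Suc by (simp add: algebra_simps)
      qed simp
      also have "\<dots> \<le> 1" by (rule level_le_1[OF elim])
      finally show ?case using e by (simp add: field_simps)
    qed
  qed
  hence "C * (\<Sum>n<N. prob (EB n)) \<le> C * (2 / e)" for N using C by (intro mult_left_mono) auto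
  moreover have "(\<Sum>n<N. prob (EA n)) \<le> C * (\<Sum>n<N. prob (EB n))" for N
    unfolding sum_distrib_left by (intro sum_mono cmp)
  ultimately have "(\<Sum>n<N. prob (EA n)) \<le> C * (2 / e)" for N by (meson order_trans)
  from AE_eventually_not[OF EA this] show ?thesis
    by (rule AE_mp) (auto simp: EA_def not_le elim!: eventually_mono)
qed

lemma AE_gap_lim_nonpos: "AE \<omega> in M. \<forall>i. gap i (level_lim (P \<omega>)) \<le> 0"
proof -
  \<comment> \<open>The shift by 50 keeps the thresholds within the range
    \<open>e \<le> 1/50\<close> of \<open>AE_gap_small\<close>.\<close>
  have "AE \<omega> in M. \<forall>i. \<forall>k::nat. eventually (\<lambda>n. gap i (level (P \<omega>) n) < 1 / (50 + real k)) sequentially"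
    unfolding AE_all_countable by (intro allI AE_gap_small) (auto simp: field_simps)
  thus ?thesis using AE_valid
  proof eventually_elim
    case (elim \<omega>)
    show ?case
    proof
      fix i
      have "gap i (level_lim (P \<omega>)) \<le> 1 / (50 + real k)" for k
      proof (rule tendsto_upperbound[OF gap_tendsto[OF elim(2)]])
        show "eventually (\<lambda>n. gap i (level (P \<omega>) n) \<le> 1 / (50 + real k)) sequentially"
          using elim(1)[rule_format, of i k] by (rule eventually_mono) simp
      qed simp
      moreover have "(\<lambda>k. 1 / (50 + real k)) \<longlonglongrightarrow> 0" by real_asymp
      ultimately show "gap i (level_lim (P \<omega>)) \<le> 0" by (intro LIMSEQ_le_const) auto
    qed
  qed
qed

end

section \<open>Excluding several open caps\<close>

definition potential :: "nat set \<Rightarrow> real \<Rightarrow> (nat \<Rightarrow> real) \<Rightarrow> real" where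
  "potential S B m = (if alive S m then B + (if late S m \<and> ripe S m then 0 else 1) else 0)"

text \<open>A kill in a ripe late state costs \<open>B\<close>, a sowing in an unripe late state
  costs 1. The potential can rise only by a hit in a ripe late state that destroys ripeness, and
  then by 1.\<close>

lemma potential_step:
  assumes S: "S \<subseteq> {..<5}" and m: "admissible m" and m': "admissible (step m x)"
    and x: "x \<in> trim m" and B: "0 \<le> B"
  shows "potential S B (step m x) + B * of_bool (late S m \<and> ripe S m \<and> kill S m x)
    + of_bool (late S m \<and> \<not> ripe S m \<and> sow S m x)
    \<le> potential S B m + of_bool (late S m \<and> ripe S m \<and> hit m x)"
proof (cases "late S m")
  case False
  thus ?thesis using alive_step[of S m x] B by (auto simp: potential_def)
next
  case l: True
  hence a: "alive S m" by (simp add: late_def)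
  show ?thesis
  proof (cases "ripe S m")
    case r: True
    have nk: "\<not> alive S (step m x)" if "kill S m x" by (rule kill_closes[OF S m m' a that])
    have nh: "step m x = m" if "\<not> hit m x"
      by (rule step_unchanged[OF m]) (use that in \<open>auto simp: hit_def not_less\<close>)
    show ?thesis using l r a nk nh B
      by (cases "kill S m x"; cases "hit m x") (auto simp: potential_def)
  next
    case r: False
    have ns: "late S (step m x) \<and> ripe S (step m x)" if "sow S m x" "alive S (step m x)"
      using sow_ripens[OF S m m' x l that(1)] late_step[OF l that(2)] by simp
    show ?thesis using l r a ns B
      by (cases "sow S m x"; cases "alive S (step m x)") (auto simp: potential_def)
  qed
qed

lemma closed_half_trim: "closed {x \<in> trim m. c \<le> x \<bullet> pent_vertex k}"
proof -
  have "{x \<in> trim m. c \<le> x \<bullet> pent_vertex k} = trim m \<inter> {x. c \<le> x \<bullet> pent_vertex k}" by auto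
  thus ?thesis by (auto intro!: closed_Int closed_trim closed_Collect_le continuous_intros)
qed

lemma closed_pair_trim:
  assumes "finite S"
  shows "closed {x \<in> trim m. \<exists>j\<in>S. \<exists>k\<in>S. Q j k \<and> c j k \<le> x \<bullet> pent_vertex (d j k)}"
proof -
  have "closed {x \<in> trim m. Q j k \<and> c j k \<le> x \<bullet> pent_vertex (d j k)}" for j k
    by (cases "Q j k") (auto intro: closed_half_trim)
  hence "closed (\<Union>j\<in>S. \<Union>k\<in>S. {x \<in> trim m. Q j k \<and> c j k \<le> x \<bullet> pent_vertex (d j k)})"
    by (intro closed_UN assms ballI)
  also have "(\<Union>j\<in>S. \<Union>k\<in>S. {x \<in> trim m. Q j k \<and> c j k \<le> x \<bullet> pent_vertex (d j k)}) =
      {x \<in> trim m. \<exists>j\<in>S. \<exists>k\<in>S. Q j k \<and> c j k \<le> x \<bullet> pent_vertex (d j k)}"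
    by blast
  finally show ?thesis .
qed

lemma closed_kill: "finite S \<Longrightarrow> closed {x \<in> trim m. kill S m x}"
  unfolding kill_def by (rule closed_pair_trim)

lemma closed_sow: "finite S \<Longrightarrow> closed {x \<in> trim m. sow S m x}"
  using closed_pair_trim[of S m "\<lambda>j k. coupled j k \<and> (\<forall>l\<in>S. gap l m \<le> gap k m) \<and> 11/20 * gap k m \<le> gap j m"
    "\<lambda>j k. m j + 9/10 * gap j m" "\<lambda>j k. j"]
  by (simp only: sow_def conj_assoc)

text \<open>The top tenth of one cap suffices if its gap is at least a third of every gap in
  \<open>S\<close>. In a ripe state the cap at \<open>k\<close> of a ripe pair has this property, as
  \<open>100/38 < 3\<close>. Otherwise let \<open>k\<close> have the largest gap: a partner
  \<open>j\<close> coupled to it has \<open>gap j > 11/20 * gap k\<close>, as the pair would be ripe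
  otherwise, and \<open>20/11 < 3\<close>.\<close>

lemma hit_area_compare:
  assumes S: "S \<subseteq> {..<5}" "S \<noteq> {}" and nb: "\<And>j. j \<in> S \<Longrightarrow> \<exists>k\<in>S. coupled j k"
    and ab: "0 < a" "0 < b"
    and upper: "\<And>i t. 0 \<le> t \<Longrightarrow> emeasure lborel (cap i t m) \<le> ennreal (b * t^2)"
    and lower: "\<And>i t. 0 \<le> t \<Longrightarrow> t \<le> 1/50 \<Longrightarrow> ennreal (a * t^2) \<le> emeasure lborel (cap i t m)"
    and m: "admissible m" and l: "late S m" and C: "C = 10000 * b / a"
  shows "ripe S m \<Longrightarrow> emeasure lborel {x \<in> trim m. hit m x} \<le> ennreal C * emeasure lborel {x \<in> trim m. kill S m x}"
    and "\<not> ripe S m \<Longrightarrow> emeasure lborel {x \<in> trim m. hit m x} \<le> ennreal C * emeasure lborel {x \<in> trim m. sow S m x}"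
proof -
  have fin: "finite S" using S finite_subset by blast
  have pos: "0 < gap i m" "gap i m \<le> 1/50" if "i \<in> S" for i
    using l that by (auto simp: late_def alive_def)
  have C0: "0 \<le> C" using ab C by simp
  note hit = hit_area_le[OF S(1) m l ab(2) upper]
  have main: "emeasure lborel {x \<in> trim m. hit m x} \<le> ennreal C * emeasure lborel A"
    if A: "A \<in> sets lborel" "cap k (gap k m / 10) m \<subseteq> A" and k: "k \<in> S"
      and G: "\<And>l. l \<in> S \<Longrightarrow> gap l m \<le> c * gap k m" and c: "0 < c" "c \<le> 3" for A k c
  proof -
    have "emeasure lborel {x \<in> trim m. hit m x} \<le> ennreal (5 * b * (c * gap k m)^2)" by (rule hit[OF _ G])
    also have "\<dots> \<le> ennreal (5 * b * (3 * gap k m)^2)"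
      using c pos[OF k] ab by (intro ennreal_leI mult_left_mono power_mono mult_right_mono) auto
    \<comment> \<open>The left side is \<open>45 * b\<close> times the squared gap, the right side
      \<open>100 * b\<close> times it.\<close>
    also have "\<dots> \<le> ennreal (C * (a * (gap k m / 10)^2))"
      using ab pos[OF k] by (intro ennreal_leI) (simp add: C power_mult_distrib power_divide)
    also have "\<dots> = ennreal C * ennreal (a * (gap k m / 10)^2)" using C0 ab by (simp add: ennreal_mult)
    also have "\<dots> \<le> ennreal C * emeasure lborel (cap k (gap k m / 10) m)"
      using pos[OF k] by (intro mult_left_mono lower) auto
    also have "\<dots> \<le> ennreal C * emeasure lborel A" using A by (intro mult_left_mono emeasure_mono) auto
    finally show ?thesis .
  qed
  show "emeasure lborel {x \<in> trim m. hit m x} \<le> ennreal C * emeasure lborel {x \<in> trim m. kill S m x}" if r: "ripe S m"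
  proof -
    from r obtain j k where jk: "j \<in> S" "k \<in> S" "ripe_pair S m j k" by (auto simp: ripe_def)
    show ?thesis
    proof (rule main[where k=k and c="100/38"])
      show "{x \<in> trim m. kill S m x} \<in> sets lborel" using closed_kill[OF fin] by simp
      show "cap k (gap k m / 10) m \<subseteq> {x \<in> trim m. kill S m x}"
      proof
        fix x assume "x \<in> cap k (gap k m / 10) m"
        hence "x \<in> trim m" "m k + 9/10 * gap k m \<le> x \<bullet> pent_vertex k" by (auto simp: cap_def)
        thus "x \<in> {x \<in> trim m. kill S m x}" using jk unfolding kill_def by blast
      qed
      show "gap l m \<le> 100/38 * gap k m" if "l \<in> S" for l
        using jk that by (auto simp: ripe_pair_def)
    qed (use jk in auto)
  qed
  show "emeasure lborel {x \<in> trim m. hit m x} \<le> ennreal C * emeasure lborel {x \<in> trim m. sow S m x}" if r: "\<not> ripe S m"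
  proof -
    have "Max ((\<lambda>i. gap i m) ` S) \<in> (\<lambda>i. gap i m) ` S" using fin S by (intro Max_in) auto
    then obtain k where k: "k \<in> S" "Max ((\<lambda>i. gap i m) ` S) = gap k m" by auto
    have kmax: "gap l m \<le> gap k m" if "l \<in> S" for l
      unfolding k(2)[symmetric] using fin that by (intro Max_ge) auto
    obtain j where j: "j \<in> S" "coupled k j" using nb[OF k(1)] by auto
    have jk: "coupled j k" by (rule coupled_sym[OF _ j(2)]) (use k S in auto)
    have "38/100 * gap l m \<le> gap k m" if "l \<in> S" for l
      using kmax[OF that] pos[OF that] pos[OF k(1)] by linarith
    hence "gap j m \<le> 11/20 * gap k m \<Longrightarrow> ripe_pair S m j k" using jk by (simp add: ripe_pair_def)
    hence gj: "11/20 * gap k m < gap j m" using r j(1) k(1) unfolding ripe_def by (meson not_le)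
    show ?thesis
    proof (rule main[where k=j and c="20/11"])
      show "{x \<in> trim m. sow S m x} \<in> sets lborel" using closed_sow[OF fin] by simp
      show "cap j (gap j m / 10) m \<subseteq> {x \<in> trim m. sow S m x}"
      proof
        fix x assume "x \<in> cap j (gap j m / 10) m"
        hence "x \<in> trim m" "m j + 9/10 * gap j m \<le> x \<bullet> pent_vertex j" by (auto simp: cap_def)
        thus "x \<in> {x \<in> trim m. sow S m x}" using j(1) k(1) jk kmax less_imp_le[OF gj] unfolding sow_def
          by blast
      qed
      show "gap l m \<le> 20/11 * gap j m" if "l \<in> S" for l
        using kmax[OF that] gj by linarith
    qed (use j in auto)
  qed
qed

context pent_process
begin

text \<open>Summing \<open>potential_step\<close> along a path and taking expectations bounds a
  weighted count of kills and sowings minus ripe hits. The area comparison bounds the probability of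
  a hit by that of a kill or a sowing, so the expected number of late hits is finite.\<close>

lemma AE_eventually_no_late_hit:
  assumes S: "S \<subseteq> {..<5}" "S \<noteq> {}" and nb: "\<And>j. j \<in> S \<Longrightarrow> \<exists>k\<in>S. coupled j k"
  shows "AE \<omega> in M. eventually (\<lambda>n. \<not> (late S (level (P \<omega>) n) \<and> hit (level (P \<omega>) n) (P \<omega> n))) sequentially"
proof -
  obtain a b where ab: "0 < a" "0 < b"
    and upper: "\<And>i m t. admissible m \<Longrightarrow> 0 \<le> t \<Longrightarrow> emeasure lborel (cap i t m) \<le> ennreal (b * t^2)"
    and lower: "\<And>i m t. admissible m \<Longrightarrow> 0 \<le> t \<Longrightarrow> t \<le> 1/50 \<Longrightarrow> ennreal (a * t^2) \<le> emeasure lborel (cap i t m)"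
    by (rule cap_area_bounds) (rule that)
  define C where "C = 10000 * b / a"
  have C: "0 \<le> C" using ab by (simp add: C_def)
  define rh where "rh m x \<longleftrightarrow> late S m \<and> ripe S m \<and> hit m x" for m x
  define rk where "rk m x \<longleftrightarrow> late S m \<and> ripe S m \<and> kill S m x" for m x
  define nh where "nh m x \<longleftrightarrow> late S m \<and> \<not> ripe S m \<and> hit m x" for m x
  define ns where "ns m x \<longleftrightarrow> late S m \<and> \<not> ripe S m \<and> sow S m x" for m x
  let ?N = "PiM UNIV (\<lambda>_::nat. borel :: real measure) \<Otimes>\<^sub>M (borel :: (real \<times> real) measure)"
  have meas: "Measurable.pred ?N (\<lambda>z. rh (fst z) (snd z))" "Measurable.pred ?N (\<lambda>z. rk (fst z) (snd z))"
    "Measurable.pred ?N (\<lambda>z. nh (fst z) (snd z))" "Measurable.pred ?N (\<lambda>z. ns (fst z) (snd z))"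
    unfolding rh_def rk_def nh_def ns_def by measurable
  define ev where "ev Q n = {\<omega> \<in> space M. Q (level (P \<omega>) n) (P \<omega> n)}" for Q :: "(nat \<Rightarrow> real) \<Rightarrow> real \<times> real \<Rightarrow> bool" and n
  have ev: "ev rh n \<in> sets M" "ev rk n \<in> sets M" "ev nh n \<in> sets M" "ev ns n \<in> sets M" for n
    unfolding ev_def by (rule sets_event[OF meas(1)] sets_event[OF meas(2)] sets_event[OF meas(3)] sets_event[OF meas(4)])+
  have cmp_rip: "prob (ev rh n) \<le> C * prob (ev rk n)" for n
    unfolding ev_def
  proof (rule prob_compare[OF meas(1,2) C])
    show "AE \<omega> in M. emeasure lborel {x \<in> trim (level (P \<omega>) n). rh (level (P \<omega>) n) x}
         \<le> ennreal C * emeasure lborel {x \<in> trim (level (P \<omega>) n). rk (level (P \<omega>) n) x}"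
      using AE_valid
    proof eventually_elim
      case (elim \<omega>)
      have m: "admissible (level (P \<omega>) n)" by (rule valid_level[OF elim])
      show ?case
        using hit_area_compare(1)[OF S nb ab upper[OF m] lower[OF m] m _ C_def]
        by (cases "late S (level (P \<omega>) n) \<and> ripe S (level (P \<omega>) n)") (auto simp: rh_def rk_def)
    qed
  qed
  have cmp_unrip: "prob (ev nh n) \<le> C * prob (ev ns n)" for n
    unfolding ev_def
  proof (rule prob_compare[OF meas(3,4) C])
    show "AE \<omega> in M. emeasure lborel {x \<in> trim (level (P \<omega>) n). nh (level (P \<omega>) n) x}
         \<le> ennreal C * emeasure lborel {x \<in> trim (level (P \<omega>) n). ns (level (P \<omega>) n) x}"
      using AE_valid
    proof eventually_elim
      case (elim \<omega>)
      have m: "admissible (level (P \<omega>) n)" by (rule valid_level[OF elim])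
      show ?case
        using hit_area_compare(2)[OF S nb ab upper[OF m] lower[OF m] m _ C_def]
        by (cases "late S (level (P \<omega>) n) \<and> \<not> ripe S (level (P \<omega>) n)") (auto simp: nh_def ns_def)
    qed
  qed
  \<comment> \<open>With this \<open>B\<close> a kill pays for the ripe hits:
    \<open>B * prob (ev rk n) - prob (ev rh n)\<close> is at least
    \<open>prob (ev rk n)\<close>.\<close>
  define B where "B = C + 1"
  have B: "0 \<le> B" using C by (simp add: B_def)
  have tele: "AE \<omega> in M. (\<Sum>n<N. B * indicator (ev rk n) \<omega> + indicator (ev ns n) \<omega> - indicator (ev rh n) \<omega>) \<le> B + 1" for N
    using AE_valid AE_space
  proof eventually_elim
    case (elim \<omega>)
    let ?V = "\<lambda>n. potential S B (level (P \<omega>) n)"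
    have stp: "?V (Suc n) + (B * indicator (ev rk n) \<omega> + indicator (ev ns n) \<omega> - indicator (ev rh n) \<omega>) \<le> ?V n" for n
    proof -
      have "P \<omega> n \<in> trim (level (P \<omega>) n)" using elim(1) by (simp add: valid_def)
      from potential_step[OF S(1) valid_level(1)[OF elim(1), of n] _ this B]
      have "?V (Suc n) + B * of_bool (rk (level (P \<omega>) n) (P \<omega> n)) + of_bool (ns (level (P \<omega>) n) (P \<omega> n))
          \<le> ?V n + of_bool (rh (level (P \<omega>) n) (P \<omega> n))"
        using valid_level(1)[OF elim(1), of "Suc n"] by (simp add: rk_def ns_def rh_def)
      thus ?thesis using elim(2) by (simp add: ev_def indicator_def of_bool_def)
    qed
    have "?V N + (\<Sum>n<N. B * indicator (ev rk n) \<omega> + indicator (ev ns n) \<omega> - indicator (ev rh n) \<omega>) \<le> ?V 0"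
    proof (induction N)
      case (Suc N)
      thus ?case using stp[of N] by (simp del: level.simps)
    qed simp
    moreover have "0 \<le> ?V N" "?V 0 \<le> B + 1" using B by (auto simp: potential_def)
    ultimately show ?case by linarith
  qed
  have total: "(\<Sum>n<N. B * prob (ev rk n) + prob (ev ns n) - prob (ev rh n)) \<le> B + 1" for N
  proof -
    have "(\<Sum>n<N. B * prob (ev rk n) + prob (ev ns n) - prob (ev rh n)) =
        (\<Sum>n<N. \<integral>\<omega>. B * indicator (ev rk n) \<omega> + indicator (ev ns n) \<omega> - indicator (ev rh n) \<omega> \<partial>M)"
      using ev by (intro sum.cong refl) (simp add: emeasure_eq_measure)
    also have "\<dots> = (\<integral>\<omega>. (\<Sum>n<N. B * indicator (ev rk n) \<omega> + indicator (ev ns n) \<omega> - indicator (ev rh n) \<omega>) \<partial>M)"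
      using ev by (intro Bochner_Integration.integral_sum[symmetric]) (auto simp: emeasure_eq_measure)
    also have "\<dots> \<le> (\<integral>\<omega>. B + 1 \<partial>M)"
      by (rule integral_mono_AE) (use ev tele in \<open>auto simp: emeasure_eq_measure\<close>)
    finally show ?thesis by (simp add: prob_space)
  qed
  define E where "E n = {\<omega> \<in> space M. late S (level (P \<omega>) n) \<and> hit (level (P \<omega>) n) (P \<omega> n)}" for n
  have E_eq: "E n = ev rh n \<union> ev nh n" for n by (auto simp: E_def ev_def rh_def nh_def)
  have "(\<Sum>n<N. prob (E n)) \<le> C * (B + 1)" for N
  proof -
    have "prob (E n) \<le> C * (B * prob (ev rk n) + prob (ev ns n) - prob (ev rh n))" for n
    proof -
      have "prob (E n) \<le> prob (ev rh n) + prob (ev nh n)" unfolding E_eq using ev by (intro measure_Un_le) auto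
      also have "\<dots> \<le> C * prob (ev rk n) + C * prob (ev ns n)" by (intro add_mono cmp_rip cmp_unrip)
      also have "\<dots> = C * (prob (ev rk n) + prob (ev ns n))" by (simp add: distrib_left)
      also have "\<dots> \<le> C * (B * prob (ev rk n) + prob (ev ns n) - prob (ev rh n))"
        using cmp_rip[of n] C by (intro mult_left_mono) (auto simp: B_def distrib_right)
      finally show ?thesis .
    qed
    hence "(\<Sum>n<N. prob (E n)) \<le> C * (\<Sum>n<N. B * prob (ev rk n) + prob (ev ns n) - prob (ev rh n))"
      unfolding sum_distrib_left by (intro sum_mono)
    also have "\<dots> \<le> C * (B + 1)" by (intro mult_left_mono total C)
    finally show ?thesis .
  qed
  moreover have "E n \<in> sets M" for n unfolding E_eq using ev by auto
  ultimately have "AE \<omega> in M. eventually (\<lambda>n. \<omega> \<notin> E n) sequentially"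
    by (intro AE_eventually_not)
  thus ?thesis using AE_space
    by eventually_elim (auto simp: E_def elim!: eventually_mono)
qed

text \<open>If \<open>S\<close> were the set of caps that stay open, the states would be late from
  some time on and eventually no point would hit. Levels would then be constant and a positive gap
  would be its own limit, against \<open>AE_gap_lim_nonpos\<close>.\<close>

lemma AE_open_set_ne:
  assumes S: "S \<subseteq> {..<5}" "S \<noteq> {}" and nb: "\<And>j. j \<in> S \<Longrightarrow> \<exists>k\<in>S. coupled j k"
  shows "AE \<omega> in M. {i. i < 5 \<and> (\<forall>n. 0 \<le> gap i (level (P \<omega>) n))} \<noteq> S"
proof -
  have "AE \<omega> in M. eventually (\<lambda>n. \<not> (late S (level (P \<omega>) n) \<and> hit (level (P \<omega>) n) (P \<omega> n))) sequentially"
    by (rule AE_eventually_no_late_hit) (use assms in auto)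
  with AE_valid AE_gap_nonzero AE_gap_lim_nonpos show ?thesis
  proof eventually_elim
    case (elim \<omega>)
    let ?g = "\<lambda>i n. gap i (level (P \<omega>) n)"
    show ?case
    proof
      assume eq: "{i. i < 5 \<and> (\<forall>n. 0 \<le> ?g i n)} = S"
      have fin: "finite S" using S finite_subset by blast
      have pos: "0 < ?g i n" if "i \<in> S" for i n
        using that eq elim(2) by (auto simp: less_le)
      have "eventually (\<lambda>n. \<forall>i\<in>S. ?g i n \<le> 1/50) sequentially"
      proof (rule eventually_ball_finite[OF fin], rule ballI)
        fix i
        have "gap i (level_lim (P \<omega>)) < 1/50" using elim(3)[rule_format, of i] by simp
        from order_tendstoD(2)[OF gap_tendsto[OF elim(1)] this]
        show "eventually (\<lambda>n. ?g i n \<le> 1/50) sequentially" by (rule eventually_mono) simp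
      qed
      moreover have "eventually (\<lambda>n. \<forall>i\<in>{..<5} - S. ?g i n < 0) sequentially"
      proof (rule eventually_ball_finite, simp, rule ballI)
        fix i assume "i \<in> {..<5} - S"
        hence "\<not> (\<forall>n. 0 \<le> ?g i n)" unfolding eq[symmetric] by blast
        then obtain N where N: "?g i N < 0" by (meson not_le)
        have "?g i n < 0" if "N \<le> n" for n
          using decseqD[OF decseq_gap_level that, of i "P \<omega>"] N by linarith
        thus "eventually (\<lambda>n. ?g i n < 0) sequentially" by (auto simp: eventually_sequentially)
      qed
      ultimately have "eventually (\<lambda>n. \<not> hit (level (P \<omega>) n) (P \<omega> n)) sequentially"
        using elim(4) by eventually_elim (use pos in \<open>auto simp: late_def alive_def\<close>)
      then obtain N where N: "\<And>n. N \<le> n \<Longrightarrow> \<not> hit (level (P \<omega>) n) (P \<omega> n)"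
        by (auto simp: eventually_sequentially)
      have const: "level (P \<omega>) n = level (P \<omega>) N" if "N \<le> n" for n
        using that
      proof (induction n rule: dec_induct)
        case (step n)
        have "step (level (P \<omega>) n) (P \<omega> n) = level (P \<omega>) n"
          by (rule step_unchanged[OF valid_level(1)[OF elim(1)]])
             (use N[OF step(1)] in \<open>auto simp: hit_def not_less\<close>)
        thus ?case using step by simp
      qed simp
      obtain i where i: "i \<in> S" using S by auto
      have "eventually (\<lambda>n. ?g i n = ?g i N) sequentially"
        unfolding eventually_sequentially by (intro exI[of _ N] allI impI arg_cong[OF const])
      hence "(\<lambda>n. ?g i n) \<longlonglongrightarrow> ?g i N" by (rule tendsto_eventually)
      hence "gap i (level_lim (P \<omega>)) = ?g i N" by (rule LIMSEQ_unique[OF gap_tendsto[OF elim(1)]])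
      thus False using elim(3)[rule_format, of i] pos[OF i, of N] by simp
    qed
  qed
qed

lemma AE_unique_height:
  "AE \<omega> in M. \<exists>i<5. pent_height (Kinf (P \<omega>)) i = rho5 \<and>
     (\<forall>j<5. j \<noteq> i \<longrightarrow> pent_height (Kinf (P \<omega>)) j < rho5)"
proof -
  \<comment> \<open>A finite family, so the exceptional null sets can be united; these are the sets
    excluded by hypothesis in \<open>unique_height\<close>.\<close>
  define F where "F = insert {..<5} ((\<lambda>i. {i, (i + 2) mod 5}) ` {..<5::nat})"
  have "AE \<omega> in M. \<forall>S\<in>F. {i. i < 5 \<and> (\<forall>n. 0 \<le> gap i (level (P \<omega>) n))} \<noteq> S"
  proof (rule AE_finite_allI)
    show "finite F" by (simp add: F_def)
    fix S assume "S \<in> F"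
    then consider "S = {..<5}" | i where "i < 5" "S = {i, (i + 2) mod 5}" by (auto simp: F_def)
    thus "AE \<omega> in M. {i. i < 5 \<and> (\<forall>n. 0 \<le> gap i (level (P \<omega>) n))} \<noteq> S"
    proof cases
      case 1
      show ?thesis
      proof (rule AE_open_set_ne)
        show "\<exists>k\<in>S. coupled j k" for j by (rule bexI[of _ "(j + 2) mod 5"]) (auto simp: 1 coupled_def)
      qed (auto simp: 1 lessThan_empty_iff)
    next
      case 2
      have c: "coupled i ((i + 2) mod 5)" by (simp add: coupled_def)
      show ?thesis
      proof (rule AE_open_set_ne)
        show "\<exists>k\<in>S. coupled j k" if "j \<in> S" for j
          using that c coupled_sym[OF 2(1) c] by (auto simp: 2)
      qed (auto simp: 2)
    qed
  qed
  thus ?thesis using AE_valid AE_gap_lim_nonpos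
  proof eventually_elim
    case (elim \<omega>)
    show ?case
      by (rule unique_height[OF elim(2)]) (use elim(1,3) in \<open>auto simp: F_def\<close>)
  qed
qed

end

theorem theorem6:
  fixes M :: "'a measure" and P :: "'a \<Rightarrow> nat \<Rightarrow> real \<times> real"
  assumes "pentagon_process M P"
  shows "AE \<omega> in M. \<exists>i<5. pent_height (Kinf (P \<omega>)) i = rho5 \<and>
           (\<forall>j<5. j \<noteq> i \<longrightarrow> pent_height (Kinf (P \<omega>)) j < rho5)"
  by (rule pent_process.AE_unique_height) (rule pent_process.intro[OF assms])

end
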